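(* Let $s > 0$, $1 \leq p < u < \infty$, $1 \leq q \leq \infty$ and $d\in\mathbb{N}$ with $d \geq 2$. Let in addition $$p \leq \frac{d-1}{d}\,u.$$ Then the space $\mathbb{E}^{s}_{u,p,q}(\mathbb{R}^d)$ does not have the Fubini property.
   Context: Morrey norm on $\mathbb{R}^n$: for $1\le p\le u<\infty$, $\Vert f\,|\,\mathcal{M}^{u}_{p}(\mathbb{R}^n)\Vert = \sup_{y\in\mathbb{R}^n,\,r>0}|B(y,r)|^{\frac1u-\frac1p}\left(\int_{B(y,r)}|f(x)|^p\,dx\right)^{1/p}$, where $B(y,r)$ is the open ball and $|\cdot|$ is Lebesgue measure. Smooth dyadic decomposition of unity: let $\varphi_0\in C_0^\infty(\mathbb{R}^n)$ be non-negative with $\varphi_0(x)=1$ if $|x|\le1$ and $\varphi_0(x)=0$ if $|x|\ge 3/2$; for $k\in\mathbb{N}$ put $\varphi_k(x)=\varphi_0(2^{-k}x)-\varphi_0(2^{-k+1}x)$. $\mathcal{F}$, $\mathcal{F}^{-1}$ denote the Fourier transform and its inverse on $\mathcal{S}'(\mathbb{R}^n)$. Real Triebel-Lizorkin-Morrey space: for $1\le p\le u<\infty$, $1\le q\le\infty$, $s>0$, $\mathbb{E}^{s}_{u,p,q}(\mathbb{R}^{n})$ is the set of all real-valued $f\in L_1^{loc}(\mathbb{R}^n)\cap\mathcal{S}'(\mathbb{R}^n)$ with $$\Vert f\,|\,\mathcal{E}^{s}_{u,p,q}(\mathbb{R}^{n})\Vert=\left\Vert\left(\sum_{k=0}^\infty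 2^{ksq}\,|\mathcal{F}^{-1}[\varphi_k\mathcal{F}f](x)|^q\right)^{1/q}\,\Big|\,\mathcal{M}^u_p(\mathbb{R}^n)\right\Vert<\infty$$ (with the sum replaced by a supremum over $k$ if $q=\infty$). Different choices of $\varphi_0$ give equivalent norms. Fubini property: let $s>0$, $1\le p\le u<\infty$, $1\le q\le\infty$, $d\ge2$. The space $\mathbb{E}^{s}_{u,p,q}(\mathbb{R}^d)$ has the Fubini property if the norm $$\Vert f\,|\,\mathcal{E}^{s}_{u,p,q}(\mathbb{R}^d)\Vert^{F}=\sum_{j=1}^{d}\Big\Vert\,\Vert f(x_1,\ldots,x_{j-1},\cdot,x_{j+1},\ldots,x_d)\,|\,\mathcal{E}^{s}_{u,p,q}(\mathbb{R})\Vert\,\Big|\,\mathcal{M}^{u}_{p}(\mathbb{R}^{d-1})\Big\Vert$$ is equivalent to $\Vert f\,|\,\mathcal{E}^{s}_{u,p,q}(\mathbb{R}^d)\Vert$; here the inner norm is taken in the $j$-th variable with the remaining $d-1$ variables fixed, the outer Morrey norm is taken in the remaining $d-1$ variables, and the value $+\infty$ is allowed. Equivalence means that there are constants $C_1,C_2>0$ independent of $f$ bounding each quantity by a multiple of the other. *)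

theory Defs
  imports "HOL-Analysis.Analysis"
begin

section \<open>Smooth functions and tempered distributions\<close>

text \<open>A multi-index is represented by a list of basis vectors: the mixed partial derivative
  along \<open>[b\<^sub>1, \<dots>, b\<^sub>m]\<close> is \<open>\<partial>\<^bsub>b\<^sub>1\<^esub> \<dots> \<partial>\<^bsub>b\<^sub>m\<^esub> f\<close>.\<close>

definition partial_deriv ::
  "'a::euclidean_space \<Rightarrow> ('a \<Rightarrow> 'b::real_normed_vector) \<Rightarrow> 'a \<Rightarrow> 'b" where
  "partial_deriv b f x = frechet_derivative f (at x) b"

definition mixed_deriv ::
  "'a::euclidean_space list \<Rightarrow> ('a \<Rightarrow> 'b::real_normed_vector) \<Rightarrow> 'a \<Rightarrow> 'b" where
  "mixed_deriv bs f = foldr partial_deriv bs f"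

definition smooth :: "('a::euclidean_space \<Rightarrow> 'b::real_normed_vector) \<Rightarrow> bool" where
  "smooth f \<longleftrightarrow> (\<forall>bs\<in>lists Basis. mixed_deriv bs f differentiable_on UNIV)"

definition test_function :: "('a::euclidean_space \<Rightarrow> 'b::real_normed_vector) \<Rightarrow> bool" where
  "test_function \<eta> \<longleftrightarrow> smooth \<eta> \<and> compact (closure {x. \<eta> x \<noteq> 0})"

definition schwartz :: "('a::euclidean_space \<Rightarrow> complex) set" where
  "schwartz = {\<eta>. smooth \<eta> \<and>
     (\<forall>N. \<forall>bs\<in>lists Basis. bounded (range (\<lambda>x. (1 + norm x) ^ N *\<^sub>R mixed_deriv bs \<eta> x)))}"

definition schwartz_seminorm :: "nat \<Rightarrow> ('a::euclidean_space \<Rightarrow> complex) \<Rightarrow> real" where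
  "schwartz_seminorm N \<eta> =
     (SUP (bs, x)\<in>{bs\<in>lists Basis. length bs \<le> N} \<times> UNIV.
        (1 + norm x) ^ N * norm (mixed_deriv bs \<eta> x))"

text \<open>Functionals are total functions in HOL, but only their values on Schwartz functions matter.\<close>

definition tempered :: "(('a::euclidean_space \<Rightarrow> complex) \<Rightarrow> complex) \<Rightarrow> bool" where
  "tempered T \<longleftrightarrow>
     (\<forall>\<eta>\<in>schwartz. \<forall>\<theta>\<in>schwartz. T (\<lambda>x. \<eta> x + \<theta> x) = T \<eta> + T \<theta>) \<and>
     (\<forall>c. \<forall>\<eta>\<in>schwartz. T (\<lambda>x. c * \<eta> x) = c * T \<eta>) \<and>
     (\<exists>N C. \<forall>\<eta>\<in>schwartz. norm (T \<eta>) \<le> C * schwartz_seminorm N \<eta>)"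

definition locally_integrable :: "('a::euclidean_space \<Rightarrow> complex) \<Rightarrow> bool" where
  "locally_integrable f \<longleftrightarrow> (\<forall>K. compact K \<longrightarrow> f absolutely_integrable_on K)"

text \<open>\<open>T\<close> is the regular distribution generated by \<open>f\<close>. The identity is only required for
  compactly supported test functions: a locally integrable \<open>f\<close> may generate a tempered
  distribution although \<open>f \<eta>\<close> is not absolutely integrable for all Schwartz functions \<open>\<eta>\<close>.
  By density, there is at most one such tempered \<open>T\<close> (as a functional on Schwartz functions).\<close>

definition generates ::
  "('a::euclidean_space \<Rightarrow> complex) \<Rightarrow> (('a \<Rightarrow> complex) \<Rightarrow> complex) \<Rightarrow> bool" where
  "generates f T \<longleftrightarrow> locally_integrable f \<and>
     (\<forall>\<eta>. test_function \<eta> \<longrightarrow> T \<eta> = (LINT x|lebesgue. f x * \<eta> x))"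

text \<open>Membership in \<open>L\<^sub>1\<^sup>l\<^sup>o\<^sup>c \<inter> S'\<close>.\<close>

definition tempered_fun :: "('a::euclidean_space \<Rightarrow> complex) \<Rightarrow> bool" where
  "tempered_fun f \<longleftrightarrow> (\<exists>T. tempered T \<and> generates f T)"

definition dist_of :: "('a::euclidean_space \<Rightarrow> complex) \<Rightarrow> ('a \<Rightarrow> complex) \<Rightarrow> complex" where
  "dist_of f = (SOME T. tempered T \<and> generates f T)"

text \<open>The continuous function generating a distribution; it is unique if it exists.\<close>

definition fun_of_dist ::
  "(('a::euclidean_space \<Rightarrow> complex) \<Rightarrow> complex) \<Rightarrow> 'a \<Rightarrow> complex" where
  "fun_of_dist T = (THE g. continuous_on UNIV g \<and> generates g T)"

definition fourier :: "('a::euclidean_space \<Rightarrow> complex) \<Rightarrow> 'a \<Rightarrow> complex" where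
  "fourier \<eta> \<xi> =
     (2 * pi) powr (- real DIM('a) / 2) *\<^sub>R (LINT x|lborel. cis (- (x \<bullet> \<xi>)) * \<eta> x)"

definition inv_fourier :: "('a::euclidean_space \<Rightarrow> complex) \<Rightarrow> 'a \<Rightarrow> complex" where
  "inv_fourier \<eta> x =
     (2 * pi) powr (- real DIM('a) / 2) *\<^sub>R (LINT \<xi>|lborel. cis (x \<bullet> \<xi>) * \<eta> \<xi>)"

definition dist_fourier ::
  "(('a::euclidean_space \<Rightarrow> complex) \<Rightarrow> complex) \<Rightarrow> ('a \<Rightarrow> complex) \<Rightarrow> complex" where
  "dist_fourier T = (\<lambda>\<eta>. T (fourier \<eta>))"

definition dist_inv_fourier ::
  "(('a::euclidean_space \<Rightarrow> complex) \<Rightarrow> complex) \<Rightarrow> ('a \<Rightarrow> complex) \<Rightarrow> complex" where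
  "dist_inv_fourier T = (\<lambda>\<eta>. T (inv_fourier \<eta>))"

definition dist_mult ::
  "('a::euclidean_space \<Rightarrow> real) \<Rightarrow> (('a \<Rightarrow> complex) \<Rightarrow> complex) \<Rightarrow> ('a \<Rightarrow> complex) \<Rightarrow> complex" where
  "dist_mult g T = (\<lambda>\<eta>. T (\<lambda>x. complex_of_real (g x) * \<eta> x))"


section \<open>Littlewood--Paley decomposition\<close>

definition dyadic_generator :: "('a::euclidean_space \<Rightarrow> real) \<Rightarrow> bool" where
  "dyadic_generator \<phi> \<longleftrightarrow> test_function \<phi> \<and> (\<forall>x. 0 \<le> \<phi> x) \<and>
     (\<forall>x. norm x \<le> 1 \<longrightarrow> \<phi> x = 1) \<and> (\<forall>x. norm x \<ge> 3 / 2 \<longrightarrow> \<phi> x = 0)"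

definition dyadic :: "('a::euclidean_space \<Rightarrow> real) \<Rightarrow> nat \<Rightarrow> 'a \<Rightarrow> real" where
  "dyadic \<phi> k x =
     (if k = 0 then \<phi> x
      else \<phi> (2 powr (- real k) *\<^sub>R x) - \<phi> (2 powr (- real k + 1) *\<^sub>R x))"

text \<open>The pointwise values of the smooth function \<open>F\<inverse>[\<phi>\<^sub>k F f]\<close>.\<close>

definition lp_block ::
  "('a::euclidean_space \<Rightarrow> real) \<Rightarrow> nat \<Rightarrow> ('a \<Rightarrow> complex) \<Rightarrow> 'a \<Rightarrow> complex" where
  "lp_block \<phi> k f =
     fun_of_dist (dist_inv_fourier (dist_mult (dyadic \<phi> k) (dist_fourier (dist_of f))))"


section \<open>Morrey norms\<close>

definition ennpowr :: "ennreal \<Rightarrow> real \<Rightarrow> ennreal" where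
  "ennpowr x a = (if x = top then top else ennreal (enn2real x powr a))"
  \<comment> \<open>only used for \<open>a > 0\<close>\<close>

text \<open>Morrey norm of a non-negative function on the metric measure space \<open>M\<close>, which will be either
  the full space or a coordinate hyperplane with its \<open>(d-1)\<close>-dimensional Lebesgue measure.
  The balls of the space \<open>M\<close> are the sets \<open>ball y r \<inter> space M\<close> with \<open>y \<in> space M\<close>. Null sets of the
  completed measure are immaterial: \<open>nn_integral\<close> does not change under completion.\<close>

definition morrey_norm ::
  "'a::euclidean_space measure \<Rightarrow> real \<Rightarrow> real \<Rightarrow> ('a \<Rightarrow> ennreal) \<Rightarrow> ennreal" where
  "morrey_norm M u p g =
     (SUP (y, r)\<in>space M \<times> {0<..}.
        ennreal (measure M (ball y r \<inter> space M) powr (1 / u - 1 / p)) *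
        ennpowr (\<integral>\<^sup>+ x\<in>ball y r \<inter> space M. ennpowr (g x) p \<partial>M) (1 / p))"

text \<open>For \<open>b \<in> Basis\<close>, the hyperplane \<open>{y. y \<bullet> b = 0}\<close> is the copy of \<open>\<real>\<^sup>d\<^sup>-\<^sup>1\<close> formed by
  all coordinates except the one belonging to \<open>b\<close>. Its Lebesgue measure is built exactly as
  \<open>lborel\<close> (see \<open>lborel_eq\<close>), omitting \<open>b\<close>.\<close>

definition hyperplane_lborel :: "'a::euclidean_space \<Rightarrow> 'a measure" where
  "hyperplane_lborel b =
     distr (\<Pi>\<^sub>M c\<in>Basis - {b}. lborel) (restrict_space borel {y. y \<bullet> b = 0})
       (\<lambda>x. \<Sum>c\<in>Basis - {b}. x c *\<^sub>R c)"

lemma space_hyperplane_lborel: "space (hyperplane_lborel b) = {y. y \<bullet> b = 0}"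
  by (simp add: hyperplane_lborel_def space_restrict_space)

lemma measurable_hyperplane_param:
  assumes "b \<in> Basis"
  shows "(\<lambda>x. \<Sum>c\<in>Basis - {b}. x c *\<^sub>R c) \<in>
    (\<Pi>\<^sub>M c\<in>Basis - {b}. lborel) \<rightarrow>\<^sub>M restrict_space borel {y. y \<bullet> b = 0}"
proof (rule measurable_restrict_space2)
  show "(\<lambda>x. \<Sum>c\<in>Basis - {b}. x c *\<^sub>R c) \<in>
      space (\<Pi>\<^sub>M c\<in>Basis - {b}. lborel) \<rightarrow> {y. y \<bullet> b = 0}"
    using assms by (auto simp: inner_sum_left inner_Basis intro!: sum.neutral)
  show "(\<lambda>x. \<Sum>c\<in>Basis - {b}. x c *\<^sub>R c) \<in> borel_measurable (\<Pi>\<^sub>M c\<in>Basis - {b}. lborel)"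
    by measurable
qed

text \<open>Lebesgue measure on \<open>\<real>\<^sup>d\<close> is the product of the hyperplane measure and Lebesgue measure on the
  remaining coordinate axis.\<close>

lemma nn_integral_lborel_hyperplane:
  fixes b :: "'a::euclidean_space"
  assumes b: "b \<in> Basis" and f [measurable]: "f \<in> borel_measurable borel"
  shows "(\<integral>\<^sup>+ x. f x \<partial>lborel) =
    (\<integral>\<^sup>+ y. (\<integral>\<^sup>+ t. f (y + t *\<^sub>R b) \<partial>lborel) \<partial>hyperplane_lborel b)"
proof -
  interpret product_sigma_finite "\<lambda>_::'a. lborel :: real measure"
    by standard
  have ins: "insert b (Basis - {b}) = Basis"
    using b by auto
  have "(\<integral>\<^sup>+ x. f x \<partial>lborel) =
      (\<integral>\<^sup>+ x. f (\<Sum>c\<in>Basis. x c *\<^sub>R c) \<partial>(\<Pi>\<^sub>M c\<in>insert b (Basis - {b}). lborel))"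
    unfolding ins by (subst lborel_eq) (simp add: nn_integral_distr)
  also have "\<dots> = (\<integral>\<^sup>+ x. (\<integral>\<^sup>+ t. f (\<Sum>c\<in>Basis. (x(b := t)) c *\<^sub>R c) \<partial>lborel)
      \<partial>(\<Pi>\<^sub>M c\<in>Basis - {b}. lborel))"
    by (rule product_nn_integral_insert) (auto simp: ins)
  also have "\<dots> = (\<integral>\<^sup>+ x. (\<integral>\<^sup>+ t. f ((\<Sum>c\<in>Basis - {b}. x c *\<^sub>R c) + t *\<^sub>R b) \<partial>lborel)
      \<partial>(\<Pi>\<^sub>M c\<in>Basis - {b}. lborel))"
  proof -
    have "(\<Sum>c\<in>Basis. (x(b := t)) c *\<^sub>R c) = (\<Sum>c\<in>Basis - {b}. x c *\<^sub>R c) + t *\<^sub>R b"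
      for x :: "'a \<Rightarrow> real" and t
      by (subst sum.remove[OF finite_Basis b]) (auto simp: add.commute intro!: sum.cong)
    then show ?thesis by simp
  qed
  also have "\<dots> = (\<integral>\<^sup>+ y. (\<integral>\<^sup>+ t. f (y + t *\<^sub>R b) \<partial>lborel) \<partial>hyperplane_lborel b)"
  proof -
    have "(\<lambda>y. \<integral>\<^sup>+ t. f (y + t *\<^sub>R b) \<partial>lborel) \<in> borel_measurable (borel :: 'a measure)"
      by measurable
    then have "(\<lambda>y. \<integral>\<^sup>+ t. f (y + t *\<^sub>R b) \<partial>lborel)
        \<in> borel_measurable (restrict_space borel {y. y \<bullet> b = 0})"
      by (rule measurable_restrict_space1)
    then show ?thesis
      unfolding hyperplane_lborel_def
      by (subst nn_integral_distr[OF measurable_hyperplane_param[OF b]]) auto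
  qed
  finally show ?thesis .
qed


section \<open>Triebel--Lizorkin--Morrey spaces and the Fubini property\<close>

text \<open>The parameter \<open>\<phi>\<close> is the generator of the decomposition of unity; \<open>q = top\<close> is allowed.
  The norm is \<open>top\<close> outside of \<open>L\<^sub>1\<^sup>l\<^sup>o\<^sup>c \<inter> S'\<close>.\<close>

definition tlm_norm ::
  "('a::euclidean_space \<Rightarrow> real) \<Rightarrow> real \<Rightarrow> real \<Rightarrow> real \<Rightarrow> ennreal \<Rightarrow> ('a \<Rightarrow> real) \<Rightarrow> ennreal" where
  "tlm_norm \<phi> s u p q f =
     (if tempered_fun (\<lambda>x. complex_of_real (f x)) then
        morrey_norm lborel u p (\<lambda>x.
          let a = (\<lambda>k. norm (lp_block \<phi> k (\<lambda>x. complex_of_real (f x)) x)) in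
          if q = top then (SUP k. ennreal (2 powr (real k * s) * a k))
          else ennpowr (\<Sum>k. ennreal (2 powr (real k * s * enn2real q) * a k powr enn2real q))
                 (1 / enn2real q))
      else top)"

definition tlm_space ::
  "('a::euclidean_space \<Rightarrow> real) \<Rightarrow> real \<Rightarrow> real \<Rightarrow> real \<Rightarrow> ennreal \<Rightarrow> ('a \<Rightarrow> real) set" where
  "tlm_space \<phi> s u p q =
     {f. tempered_fun (\<lambda>x. complex_of_real (f x)) \<and> tlm_norm \<phi> s u p q f < top}"

text \<open>Here \<open>\<psi>\<close> generates the decomposition of unity on the real line. The point
  \<open>y + t *\<^sub>R b\<close> with \<open>y \<bullet> b = 0\<close> has the coordinate \<open>t\<close> in direction \<open>b\<close> and those of \<open>y\<close> in
  the remaining directions.\<close>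

definition tlm_fubini_norm ::
  "(real \<Rightarrow> real) \<Rightarrow> real \<Rightarrow> real \<Rightarrow> real \<Rightarrow> ennreal \<Rightarrow> ('a::euclidean_space \<Rightarrow> real) \<Rightarrow> ennreal" where
  "tlm_fubini_norm \<psi> s u p q f =
     (\<Sum>b\<in>Basis. morrey_norm (hyperplane_lborel b) u p
        (\<lambda>y. tlm_norm \<psi> s u p q (\<lambda>t. f (y + t *\<^sub>R b))))"

definition fubini_property ::
  "('a::euclidean_space \<Rightarrow> real) \<Rightarrow> (real \<Rightarrow> real) \<Rightarrow> real \<Rightarrow> real \<Rightarrow> real \<Rightarrow> ennreal \<Rightarrow> bool" where
  "fubini_property \<phi> \<psi> s u p q \<longleftrightarrow>
     (\<exists>C1>0. \<exists>C2>0. \<forall>f\<in>tlm_space \<phi> s u p q.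
        tlm_norm \<phi> s u p q f \<le> ennreal C1 * tlm_fubini_norm \<psi> s u p q f \<and>
        tlm_fubini_norm \<psi> s u p q f \<le> ennreal C2 * tlm_norm \<phi> s u p q f)"

end

theory Submission
  imports Defs "HOL-Probability.Probability"
begin

text \<open>The Fubini norm measures one-dimensional slices by a Morrey norm on the line, and no nonzero
  constant has a finite Morrey norm there, since \<open>u < \<infinity>\<close>. On \<open>\<real>\<^sup>d\<close>, however, a function may be
  constant in one direction and still have a finite Morrey norm, provided that it is bounded and decays in the other
  \<open>d - 1\<close> directions: its \<open>p\<close>-th power then has an integral of order \<open>r\<close> over balls of radius \<open>r \<ge> 1\<close>, so the Morrey
  quotient (the expression under the supremum) is of order \<open>r\<^sup>e\<close> with
  \<open>e = d (1/u - 1/p) + 1/p = d/u - (d-1)/p\<close>, and \<open>e \<le> 0\<close> is the hypothesis \<open>p \<le> (d-1)/d u\<close>.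
  For such a function the \<open>d\<close>-dimensional norm is finite and the Fubini norm is infinite. Hence the second
  inequality of the Fubini property fails, whatever the constant is.

  The weights \<open>2\<^sup>k\<^sup>s\<close> are kept under control by choosing the function band-limited, with frequencies in the unit
  ball: then the Littlewood--Paley block with index 0 is the function itself and all other blocks vanish
  (\<open>lp_block_band_limited\<close>), so that the Triebel--Lizorkin--Morrey norm is just the Morrey norm
  (\<open>tlm_norm_band_limited\<close>). The concrete choice is \<open>ridge b\<close>, a product of Fejer kernels in all
  coordinates except the one of \<open>b\<close>. Its Morrey norm is estimated in \<open>morrey_norm_ridge_finite\<close>; its slices are
  dealt with in \<open>tlm_norm_const_eq_top\<close>, and their contribution to the Fubini norm in
  \<open>morrey_norm_hyperplane_eq_top\<close>.

  Most of the work goes into computing the blocks. They are defined through Fourier transforms of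
  tempered distributions, and a regular distribution is described by its generating function on compactly supported
  functions only. So one needs that a tempered distribution generated by a bounded function is given
  by the integral on all Schwartz functions (\<open>tempered_generates_schwartz\<close>, by cut-off), that the Fourier
  transform maps test functions to Schwartz functions (\<open>fourier_test_schwartz\<close>), Fourier inversion for test
  functions (\<open>fourier_inversion\<close>, by Gaussian summation), and that a continuous function is determined by the distribution
  that it generates (\<open>continuous_generates_unique\<close>).\<close>

section \<open>Smooth functions and the Leibniz rule\<close>

lemma partial_deriv_eq:
  assumes "(f has_derivative f') (at x)"
  shows "partial_deriv b f x = f' b"
  using frechet_derivative_at[OF assms] by (simp add: partial_deriv_def)

lemma mixed_deriv_simps [simp]:
  "mixed_deriv [] f = f"
  "mixed_deriv (b # bs) f = partial_deriv b (mixed_deriv bs f)"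
  by (simp_all add: mixed_deriv_def)

lemma mixed_deriv_snoc: "mixed_deriv (bs @ [b]) f = mixed_deriv bs (partial_deriv b f)"
  by (simp add: mixed_deriv_def)

lemma smooth_has_derivative:
  assumes "smooth f" "bs \<in> lists Basis"
  shows "(mixed_deriv bs f has_derivative frechet_derivative (mixed_deriv bs f) (at x)) (at x)"
  using assms by (auto simp: smooth_def differentiable_on_def frechet_derivative_works)

lemma smooth_has_derivative':
  assumes "smooth f"
  shows "(f has_derivative frechet_derivative f (at x)) (at x)"
  using smooth_has_derivative[OF assms, of "[]"] by simp

lemma smooth_continuous:
  assumes "smooth f" "bs \<in> lists Basis"
  shows "continuous_on UNIV (mixed_deriv bs f)"
  using assms by (auto simp: smooth_def intro: differentiable_imp_continuous_on)

lemma smooth_continuous': "smooth f \<Longrightarrow> continuous_on UNIV f"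
  using smooth_continuous[of f "[]"] by simp

text \<open>Smoothness is a greatest fixed point: it suffices to exhibit a class of differentiable functions that
  is closed under partial derivatives.\<close>

lemma smooth_coinduct:
  assumes "P f"
    and "\<And>f. P f \<Longrightarrow> f differentiable_on UNIV"
    and "\<And>f b. P f \<Longrightarrow> b \<in> Basis \<Longrightarrow> P (partial_deriv b f)"
  shows "smooth f"
proof -
  have "P (mixed_deriv bs f)" if "bs \<in> lists Basis" for bs
    using that by (induction bs) (auto intro: assms)
  then show ?thesis
    unfolding smooth_def using assms(2) by blast
qed

lemma smooth_partial_deriv:
  assumes "smooth f" "b \<in> Basis"
  shows "smooth (partial_deriv b f)"
  unfolding smooth_def
proof
  fix bs :: "'a list" assume "bs \<in> lists Basis"
  then have "bs @ [b] \<in> lists Basis" using assms by simp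
  then show "mixed_deriv bs (partial_deriv b f) differentiable_on UNIV"
    using assms(1) unfolding smooth_def mixed_deriv_snoc[symmetric] by blast
qed

lemma mixed_deriv_bounded_linear:
  assumes L: "bounded_linear L" and f: "smooth f" and bs: "bs \<in> lists Basis"
  shows "mixed_deriv bs (\<lambda>x. L (f x)) = (\<lambda>x. L (mixed_deriv bs f x))"
  using bs
proof (induction bs)
  case (Cons b bs)
  then have "(mixed_deriv bs f has_derivative frechet_derivative (mixed_deriv bs f) (at x)) (at x)" for x
    using smooth_has_derivative[OF f] by auto
  then have "partial_deriv b (\<lambda>x. L (mixed_deriv bs f x)) x = L (partial_deriv b (mixed_deriv bs f) x)" for x
    by (subst partial_deriv_eq[OF bounded_linear.has_derivative[OF L]]) (auto simp: partial_deriv_def)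
  then show ?case
    using Cons by auto
qed simp

lemma mixed_deriv_diff:
  assumes f: "smooth f" and g: "smooth g" and bs: "bs \<in> lists Basis"
  shows "mixed_deriv bs (\<lambda>x. f x - g x) = (\<lambda>x. mixed_deriv bs f x - mixed_deriv bs g x)"
  using bs
proof (induction bs)
  case (Cons b bs)
  then have "(mixed_deriv bs f has_derivative frechet_derivative (mixed_deriv bs f) (at x)) (at x)"
    "(mixed_deriv bs g has_derivative frechet_derivative (mixed_deriv bs g) (at x)) (at x)" for x
    using smooth_has_derivative[OF f] smooth_has_derivative[OF g] by auto
  then have "partial_deriv b (\<lambda>x. mixed_deriv bs f x - mixed_deriv bs g x) x =
      partial_deriv b (mixed_deriv bs f) x - partial_deriv b (mixed_deriv bs g) x" for x
    by (subst partial_deriv_eq[OF has_derivative_diff]) (auto simp: partial_deriv_def)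
  then show ?case
    using Cons by auto
qed simp

text \<open>Each derivative pulls one factor \<open>c\<close> out of the dilation; for cut-off functions \<open>c \<le> 1\<close>, so
  dilating does not increase any derivative.\<close>

lemma mixed_deriv_affine:
  fixes f :: "'a::euclidean_space \<Rightarrow> 'b::real_normed_vector"
  assumes f: "smooth f" and bs: "bs \<in> lists Basis"
  shows "mixed_deriv bs (\<lambda>x. f (c *\<^sub>R x + v)) =
    (\<lambda>x. c ^ length bs *\<^sub>R mixed_deriv bs f (c *\<^sub>R x + v))"
  using bs
proof (induction bs)
  case (Cons b bs)
  let ?g = "mixed_deriv bs f" and ?n = "length bs"
  show ?case
  proof
    fix x
    let ?D = "frechet_derivative ?g (at (c *\<^sub>R x + v))"
    have D: "(?g has_derivative ?D) (at (c *\<^sub>R x + v))"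
      using Cons by (intro smooth_has_derivative[OF f]) auto
    have "((\<lambda>x. ?g (c *\<^sub>R x + v)) has_derivative (\<lambda>h. ?D (c *\<^sub>R h))) (at x)"
      by (rule has_derivative_compose[where f="\<lambda>x. c *\<^sub>R x + v", OF _ D]) (auto intro!: derivative_eq_intros)
    then have "((\<lambda>x. c ^ ?n *\<^sub>R ?g (c *\<^sub>R x + v)) has_derivative (\<lambda>h. c ^ ?n *\<^sub>R ?D (c *\<^sub>R h))) (at x)"
      by (rule has_derivative_scaleR_right)
    moreover have "?D (c *\<^sub>R b) = c *\<^sub>R ?D b"
      using has_derivative_linear[OF D] by (rule linear_scale)
    ultimately show "mixed_deriv (b # bs) (\<lambda>x. f (c *\<^sub>R x + v)) x =
        c ^ length (b # bs) *\<^sub>R mixed_deriv (b # bs) f (c *\<^sub>R x + v)"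
      using Cons by (simp add: partial_deriv_eq) (simp add: partial_deriv_def mult.commute)
  qed
qed simp

lemma smooth_bounded_linear:
  fixes f :: "'a::euclidean_space \<Rightarrow> 'b::real_normed_vector"
  assumes "bounded_linear L" "smooth f"
  shows "smooth (\<lambda>x. L (f x))"
  unfolding smooth_def differentiable_on_def differentiable_def
proof (intro ballI exI)
  fix bs :: "'a list" and x assume bs: "bs \<in> lists Basis"
  show "(mixed_deriv bs (\<lambda>x. L (f x)) has_derivative
      (\<lambda>h. L (frechet_derivative (mixed_deriv bs f) (at x) h))) (at x)"
    unfolding mixed_deriv_bounded_linear[OF assms bs]
    by (rule bounded_linear.has_derivative[OF assms(1) smooth_has_derivative[OF assms(2) bs]])
qed

lemma smooth_diff: "smooth f \<Longrightarrow> smooth g \<Longrightarrow> smooth (\<lambda>x. f x - g x)"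
  using mixed_deriv_diff[of f g] by (auto simp: smooth_def)

lemma smooth_affine: 
  assumes "smooth f"
  shows "smooth (\<lambda>x. f (c *\<^sub>R x + v))"
  unfolding smooth_def differentiable_on_def
proof (intro ballI)
  fix bs :: "'a list" and x :: 'a assume bs: "bs \<in> lists Basis"
  have "(mixed_deriv bs f) differentiable (at (c *\<^sub>R x + v))"
    using smooth_has_derivative[OF assms bs] by (auto simp: differentiable_def)
  then have "(\<lambda>x. mixed_deriv bs f (c *\<^sub>R x + v)) differentiable (at x)"
    by (rule differentiable_compose) (intro derivative_intros)
  then show "mixed_deriv bs (\<lambda>x. f (c *\<^sub>R x + v)) differentiable (at x)"
    unfolding mixed_deriv_affine[OF assms bs] by (intro differentiable_scaleR differentiable_const)
qed

lemma partial_deriv_inner: "partial_deriv b (\<lambda>x. c + x \<bullet> v) = (\<lambda>x. b \<bullet> v)"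
  by (rule ext, rule partial_deriv_eq) (auto intro!: derivative_eq_intros)

lemma smooth_inner: "smooth (\<lambda>x. c + x \<bullet> v)"
proof (rule smooth_coinduct[where P = "\<lambda>f. \<exists>c v. f = (\<lambda>x. c + x \<bullet> v)"])
  show "\<exists>c v. partial_deriv b f = (\<lambda>x. c + x \<bullet> v)" if "\<exists>c v. f = (\<lambda>x. c + x \<bullet> v)" for f and b :: 'a
  proof -
    from that obtain c v where "f = (\<lambda>x. c + x \<bullet> v)" by blast
    then have "partial_deriv b f = (\<lambda>x. b \<bullet> v + x \<bullet> 0)"
      by (simp add: partial_deriv_inner)
    then show ?thesis by blast
  qed
qed (auto simp: differentiable_on_def)

lemma mixed_deriv_const:
  assumes "bs \<noteq> []"
  shows "mixed_deriv bs (\<lambda>x. c) = (\<lambda>x. 0)"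
proof -
  have "partial_deriv b (\<lambda>x. c) = (\<lambda>x. 0)" for b :: 'a and c :: 'b
    by (rule ext, rule partial_deriv_eq) auto
  moreover from this have "mixed_deriv bs (\<lambda>x. 0 :: 'b) = (\<lambda>x. 0)" for bs :: "'a list"
    by (induction bs) auto
  ultimately show ?thesis
    using assms by (cases bs rule: rev_cases) (auto simp: mixed_deriv_snoc)
qed

text \<open>The Leibniz rule as a list: all ways to let each differentiation in a mixed derivative hit one of two
  factors, repetitions included.\<close>

fun splits :: "'a list \<Rightarrow> ('a list \<times> 'a list) list" where
  "splits [] = [([], [])]"
| "splits (b # bs) = map (\<lambda>(cs, ds). (b # cs, ds)) (splits bs) @ map (\<lambda>(cs, ds). (cs, b # ds)) (splits bs)"

lemma splits_subset:
  "(cs, ds) \<in> set (splits bs) \<Longrightarrow> bs \<in> lists A \<Longrightarrow>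
    cs \<in> lists A \<and> ds \<in> lists A \<and> length cs \<le> length bs \<and> length ds \<le> length bs"
  by (induction bs arbitrary: cs ds) fastforce+

lemma length_splits: "length (splits bs) = 2 ^ length bs"
  by (induction bs) auto

lemma has_derivative_sum_list:
  assumes "\<And>i. i \<in> set L \<Longrightarrow> (f i has_derivative f' i) F"
  shows "((\<lambda>x. \<Sum>i\<leftarrow>L. f i x) has_derivative (\<lambda>h. \<Sum>i\<leftarrow>L. f' i h)) F"
  using assms by (induction L) (auto intro!: has_derivative_add)

lemma
  fixes a :: "'a::euclidean_space \<Rightarrow> real" and f :: "'a \<Rightarrow> 'b::real_normed_vector"
  assumes a: "smooth a" and f: "smooth f"
  shows mixed_deriv_scaleR: "bs \<in> lists Basis \<Longrightarrow> mixed_deriv bs (\<lambda>x. a x *\<^sub>R f x) =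
      (\<lambda>x. \<Sum>(cs, ds)\<leftarrow>splits bs. mixed_deriv cs a x *\<^sub>R mixed_deriv ds f x)"
    and smooth_scaleR: "smooth (\<lambda>x. a x *\<^sub>R f x)"
proof -
  have D: "((\<lambda>x. \<Sum>(cs, ds)\<leftarrow>splits bs. mixed_deriv cs a x *\<^sub>R mixed_deriv ds f x) has_derivative
      (\<lambda>h. \<Sum>(cs, ds)\<leftarrow>splits bs. mixed_deriv cs a x *\<^sub>R frechet_derivative (mixed_deriv ds f) (at x) h
        + frechet_derivative (mixed_deriv cs a) (at x) h *\<^sub>R mixed_deriv ds f x)) (at x)"
    if "bs \<in> lists Basis" for bs x
    unfolding case_prod_unfold
  proof (rule has_derivative_sum_list)
    fix i assume "i \<in> set (splits bs)"
    then have "fst i \<in> lists Basis" "snd i \<in> lists Basis"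
      using splits_subset[of "fst i" "snd i" bs] that by auto
    then show "((\<lambda>x. mixed_deriv (fst i) a x *\<^sub>R mixed_deriv (snd i) f x) has_derivative 
      (\<lambda>h. mixed_deriv (fst i) a x *\<^sub>R frechet_derivative (mixed_deriv (snd i) f) (at x) h
        + frechet_derivative (mixed_deriv (fst i) a) (at x) h *\<^sub>R mixed_deriv (snd i) f x)) (at x)"
      by (intro has_derivative_scaleR smooth_has_derivative a f)
  qed
  show eq: "mixed_deriv bs (\<lambda>x. a x *\<^sub>R f x) =
      (\<lambda>x. \<Sum>(cs, ds)\<leftarrow>splits bs. mixed_deriv cs a x *\<^sub>R mixed_deriv ds f x)"
    if "bs \<in> lists Basis" for bs
    using that
  proof (induction bs)
    case (Cons b bs)
    then have bs: "bs \<in> lists Basis" by auto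
    show ?case
      unfolding mixed_deriv_simps Cons.IH
      by (rule ext, subst partial_deriv_eq[OF D[OF bs]])
        (simp add: case_prod_unfold sum_list_addf partial_deriv_def o_def)
  qed simp
  show "smooth (\<lambda>x. a x *\<^sub>R f x)"
    unfolding smooth_def differentiable_on_def differentiable_def
  proof (intro ballI)
    fix bs :: "'a list" and x assume bs: "bs \<in> lists Basis"
    show "\<exists>D. (mixed_deriv bs (\<lambda>x. a x *\<^sub>R f x) has_derivative D) (at x)"
      unfolding eq[OF bs] by (rule exI, rule D[OF bs])
  qed
qed

lemma norm_sum_list_le: "norm (\<Sum>i\<leftarrow>L. f i) \<le> (\<Sum>i\<leftarrow>L. norm (f i))"
  by (induction L) (auto intro: order_trans[OF norm_triangle_ineq])

text \<open>A crude form of the Leibniz rule: a derivative of order \<open>m\<close> of a product is a sum of \<open>2\<^sup>m\<close> products.\<close>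

lemma mixed_deriv_scaleR_le:
  fixes a :: "'a::euclidean_space \<Rightarrow> real" and f :: "'a \<Rightarrow> 'b::real_normed_vector"
  assumes a: "smooth a" and f: "smooth f" and bs: "bs \<in> lists Basis"
    and A: "\<And>cs. cs \<in> lists Basis \<Longrightarrow> length cs \<le> length bs \<Longrightarrow> \<bar>mixed_deriv cs a x\<bar> \<le> A"
    and F: "\<And>ds. ds \<in> lists Basis \<Longrightarrow> length ds \<le> length bs \<Longrightarrow> norm (mixed_deriv ds f x) \<le> B"
  shows "norm (mixed_deriv bs (\<lambda>x. a x *\<^sub>R f x) x) \<le> 2 ^ length bs * (A * B)"
proof -
  have "norm (mixed_deriv bs (\<lambda>x. a x *\<^sub>R f x) x) \<le>
      (\<Sum>i\<leftarrow>splits bs. norm (mixed_deriv (fst i) a x *\<^sub>R mixed_deriv (snd i) f x))"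
    unfolding mixed_deriv_scaleR[OF a f bs] case_prod_unfold
    by (rule norm_sum_list_le)
  also have "\<dots> \<le> (\<Sum>i\<leftarrow>splits bs. A * B)"
  proof (rule sum_list_mono)
    fix i assume "i \<in> set (splits bs)"
    then have i: "fst i \<in> lists Basis" "snd i \<in> lists Basis" 
      "length (fst i) \<le> length bs" "length (snd i) \<le> length bs"
      using splits_subset[of "fst i" "snd i" bs] bs by auto
    have "0 \<le> A" using A[of "[]"] by simp
    then show "norm (mixed_deriv (fst i) a x *\<^sub>R mixed_deriv (snd i) f x) \<le> A * B"
      using A[OF i(1,3)] F[OF i(2,4)] by (auto intro!: mult_mono)
  qed
  also have "\<dots> = 2 ^ length bs * (A * B)"
    by (simp add: sum_list_triv length_splits)
  finally show ?thesis .
qed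

section \<open>Test functions and Schwartz functions\<close>

lemma mixed_deriv_eq_0_on_open:
  assumes "open S" "\<And>x. x \<in> S \<Longrightarrow> f x = 0" "x \<in> S"
  shows "mixed_deriv bs f x = 0"
  using assms(3)
proof (induction bs arbitrary: x)
  case (Cons b bs)
  have "(mixed_deriv bs f has_derivative (\<lambda>h. 0)) (at x)"
    by (rule has_derivative_transform_within_open[OF has_derivative_const assms(1) Cons.prems])
      (simp add: Cons.IH)
  then show ?case
    by (simp add: partial_deriv_eq)
qed (simp add: assms(2))

text \<open>A radius of the support is easier to carry through products, dilations and derivatives than the closure of
  the support.\<close>

lemma test_function_iff:
  "test_function f \<longleftrightarrow> smooth f \<and> (\<exists>R. \<forall>x. R < norm x \<longrightarrow> f x = 0)"
  by (auto simp: test_function_def bounded_iff not_le[symmetric])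

lemma test_function_mixed_deriv:
  assumes "test_function f" "bs \<in> lists Basis"
  shows "test_function (mixed_deriv bs f)"
proof -
  obtain R where R: "\<forall>x. R < norm x \<longrightarrow> f x = 0"
    using assms(1) by (auto simp: test_function_iff)
  have "open {x::'a. R < norm x}"
    by (intro open_Collect_less continuous_intros)
  then have "\<forall>x. R < norm x \<longrightarrow> mixed_deriv bs f x = 0"
    using mixed_deriv_eq_0_on_open[of "{x. R < norm x}" f] R by auto
  moreover have "smooth (mixed_deriv bs f)"
    using assms(2) by (induction bs) (use assms(1) in \<open>auto simp: test_function_iff intro: smooth_partial_deriv\<close>)
  ultimately show ?thesis
    by (auto simp: test_function_iff)
qed

lemma bounded_compact_support:
  fixes h :: "'a::euclidean_space \<Rightarrow> 'b::real_normed_vector"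
  assumes "continuous_on UNIV h" "\<And>x. R < norm x \<Longrightarrow> h x = 0"
  obtains B where "B \<ge> 0" "\<And>x. norm (h x) \<le> B"
proof -
  have "compact (h ` cball 0 R)"
    by (intro compact_continuous_image continuous_on_subset[OF assms(1)]) auto
  then obtain B where B: "\<forall>y\<in>h ` cball 0 R. norm y \<le> B"
    using compact_imp_bounded bounded_iff by blast
  have "norm (h x) \<le> max B 0" for x
    using B assms(2)[of x] by (cases "R < norm x") (auto simp: le_max_iff_disj)
  then show ?thesis
    using that[of "max B 0"] by auto
qed

lemma test_function_bounded:
  assumes "test_function f"
  obtains B where "B \<ge> 0" "\<And>x. norm (f x) \<le> B"
  using assms bounded_compact_support[of f] smooth_continuous'[of f]
  by (auto simp: test_function_iff)

lemma test_function_integrable: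
  fixes f :: "'a::euclidean_space \<Rightarrow> complex"
  assumes "test_function f"
  shows "integrable lborel f"
proof -
  obtain R where R: "\<forall>x. R < norm x \<longrightarrow> f x = 0"
    using assms by (auto simp: test_function_iff)
  have "continuous_on UNIV f"
    using assms by (auto simp: test_function_iff intro: smooth_continuous')
  then have "integrable lborel (\<lambda>x. indicator (cball 0 R) x *\<^sub>R f x)"
    by (intro borel_integrable_compact) (auto intro: continuous_on_subset)
  also have "(\<lambda>x. indicator (cball 0 R) x *\<^sub>R f x) = f"
    using R by (force simp: indicator_def)
  finally show ?thesis .
qed

lemma test_function_scaleR:
  fixes f :: "'a::euclidean_space \<Rightarrow> 'b::real_normed_vector"
  assumes "smooth a" "smooth f" "test_function a \<or> test_function f"
  shows "test_function (\<lambda>x. a x *\<^sub>R f x)"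
  using assms smooth_scaleR[OF assms(1,2)] by (fastforce simp: test_function_iff)

lemma test_function_bounded_linear:
  fixes f :: "'a::euclidean_space \<Rightarrow> 'b::real_normed_vector"
  assumes "bounded_linear L" "test_function f"
  shows "test_function (\<lambda>x. L (f x))"
  using assms smooth_bounded_linear[OF assms(1)]
  by (fastforce simp: test_function_iff linear_0[OF bounded_linear.linear[OF assms(1)]])

lemma test_function_affine:
  fixes f :: "'a::euclidean_space \<Rightarrow> 'b::real_normed_vector"
  assumes "test_function f" "c \<noteq> 0"
  shows "test_function (\<lambda>x. f (c *\<^sub>R x + v))"
proof -
  obtain R where R: "\<forall>x. R < norm x \<longrightarrow> f x = 0"
    using assms by (auto simp: test_function_iff)
  have "f (c *\<^sub>R x + v) = 0" if "(R + norm v) / \<bar>c\<bar> < norm x" for x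
  proof -
    have "R + norm v < norm (c *\<^sub>R x)"
      using that assms(2) by (simp add: field_simps)
    moreover have "norm (c *\<^sub>R x) \<le> norm (c *\<^sub>R x + v) + norm v"
      using norm_triangle_ineq4[of "c *\<^sub>R x + v" v] by simp
    ultimately show ?thesis using R by simp
  qed
  then show ?thesis
    using assms smooth_affine[of f c v] by (auto simp: test_function_iff)
qed

lemma schwartz_iff:
  "f \<in> schwartz \<longleftrightarrow> smooth f \<and>
    (\<forall>N. \<forall>bs\<in>lists Basis. \<exists>B. \<forall>x. (1 + norm x) ^ N * norm (mixed_deriv bs f x) \<le> B)"
  by (auto simp: schwartz_def bounded_iff power_abs abs_of_nonneg)

lemma test_function_schwartz:
  fixes f :: "'a::euclidean_space \<Rightarrow> complex"
  assumes "test_function f"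
  shows "f \<in> schwartz"
  unfolding schwartz_iff
proof (intro conjI allI ballI)
  show "smooth f" using assms by (simp add: test_function_iff)
  fix N and bs :: "'a list" assume "bs \<in> lists Basis"
  then have t: "test_function (mixed_deriv bs f)"
    by (rule test_function_mixed_deriv[OF assms])
  then obtain R where R: "\<forall>x. R < norm x \<longrightarrow> mixed_deriv bs f x = 0"
    by (auto simp: test_function_iff)
  have "continuous_on UNIV (\<lambda>x. (1 + norm x) ^ N *\<^sub>R mixed_deriv bs f x)"
    using t by (intro continuous_intros smooth_continuous') (auto simp: test_function_iff)
  moreover have "(1 + norm x) ^ N *\<^sub>R mixed_deriv bs f x = 0" if "R < norm x" for x
    using R that by simp
  ultimately obtain B where "\<And>x. norm ((1 + norm x) ^ N *\<^sub>R mixed_deriv bs f x) \<le> B"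
    using bounded_compact_support[of "\<lambda>x. (1 + norm x) ^ N *\<^sub>R mixed_deriv bs f x" R] by metis
  then show "\<exists>B. \<forall>x. (1 + norm x) ^ N * norm (mixed_deriv bs f x) \<le> B"
    by (auto simp: power_abs abs_of_nonneg)
qed

lemma schwartz_diff:
  assumes "f \<in> schwartz" "g \<in> schwartz"
  shows "(\<lambda>x. f x - g x) \<in> schwartz"
  unfolding schwartz_iff
proof (intro conjI allI ballI)
  have s: "smooth f" "smooth g" using assms by (auto simp: schwartz_iff)
  then show "smooth (\<lambda>x. f x - g x)" by (rule smooth_diff)
  fix N and bs :: "'a list" assume bs: "bs \<in> lists Basis"
  then obtain A B where A: "\<forall>x. (1 + norm x) ^ N * norm (mixed_deriv bs f x) \<le> A"
    and B: "\<forall>x. (1 + norm x) ^ N * norm (mixed_deriv bs g x) \<le> B"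
    using assms unfolding schwartz_iff by meson
  have "(1 + norm x) ^ N * norm (mixed_deriv bs f x - mixed_deriv bs g x) \<le> A + B" for x
  proof -
    have "(1 + norm x) ^ N * norm (mixed_deriv bs f x - mixed_deriv bs g x) \<le>
        (1 + norm x) ^ N * (norm (mixed_deriv bs f x) + norm (mixed_deriv bs g x))"
      by (intro mult_left_mono norm_triangle_ineq4) auto
    also have "\<dots> \<le> A + B" using A B by (auto simp: distrib_left intro: add_mono)
    finally show ?thesis .
  qed
  then show "\<exists>B. \<forall>x. (1 + norm x) ^ N * norm (mixed_deriv bs (\<lambda>x. f x - g x) x) \<le> B"
    unfolding mixed_deriv_diff[OF s bs] by blast
qed

text \<open>The supremum that defines the seminorm is one of real numbers, so it bounds its members only if they are
  bounded. They are, since only finitely many mixed derivatives are involved.\<close>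

lemma schwartz_seminorm_upper:
  fixes f :: "'a::euclidean_space \<Rightarrow> complex"
  assumes f: "f \<in> schwartz" and "bs \<in> lists Basis" "length bs \<le> N"
  shows "(1 + norm x) ^ N * norm (mixed_deriv bs f x) \<le> schwartz_seminorm N f"
proof -
  let ?S = "{bs\<in>lists (Basis :: 'a set). length bs \<le> N}"
  let ?F = "\<lambda>(bs, x). (1 + norm x) ^ N * norm (mixed_deriv bs f x)"
  obtain B where B: "\<And>bs x. bs \<in> ?S \<Longrightarrow> (1 + norm x) ^ N * norm (mixed_deriv bs f x) \<le> B bs"
    using f unfolding schwartz_iff by simp metis
  have fin: "finite ?S"
    using finite_lists_length_le[of "Basis :: 'a set" N] by (simp add: lists_eq_set)
  have "?F i \<le> (\<Sum>bs\<in>?S. \<bar>B bs\<bar>)" if "i \<in> ?S \<times> UNIV" for i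
  proof -
    have "?F i \<le> \<bar>B (fst i)\<bar>"
    proof -
      have i: "fst i \<in> ?S" using that by (rule mem_Times_iff[THEN iffD1, THEN conjunct1])
      show ?thesis
        using order_trans[OF B[OF i, of "snd i"] abs_ge_self] by (simp only: case_prod_unfold)
    qed
    also have "\<dots> \<le> (\<Sum>bs\<in>?S. \<bar>B bs\<bar>)"
      using that by (intro member_le_sum fin) auto
    finally show ?thesis .
  qed
  then have "bdd_above (?F ` (?S \<times> UNIV))"
    by (rule bdd_aboveI2)
  then have "?F (bs, x) \<le> schwartz_seminorm N f"
    unfolding schwartz_seminorm_def using assms by (intro cSUP_upper) auto
  then show ?thesis by simp
qed

lemma schwartz_seminorm_least:
  fixes f :: "'a::euclidean_space \<Rightarrow> complex"
  assumes "\<And>bs x. bs \<in> lists Basis \<Longrightarrow> length bs \<le> N \<Longrightarrow>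
    (1 + norm x) ^ N * norm (mixed_deriv bs f x) \<le> B"
  shows "schwartz_seminorm N f \<le> B"
  unfolding schwartz_seminorm_def
proof (rule cSUP_least)
  have "([], 0) \<in> {bs\<in>lists (Basis :: 'a set). length bs \<le> N} \<times> UNIV"
    by simp
  then show "{bs\<in>lists (Basis :: 'a set). length bs \<le> N} \<times> UNIV \<noteq> {}"
    by blast
qed (use assms in auto)

lemma integrable_inverse_1_plus_square_real: "integrable lborel (\<lambda>x::real. inverse (1 + x\<^sup>2))"
  using integrable_inverse_1_plus_square by (simp add: set_integrable_def einterval_def)

text \<open>With the exponent \<open>2 d\<close> the function is dominated by a product of one-dimensional functions,
  because \<open>(1 + |x|)\<^sup>2 \<ge> 1 + x\<^sub>b\<^sup>2\<close> for every coordinate \<open>x\<^sub>b\<close>.\<close>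

lemma integrable_decay: "integrable lborel (\<lambda>x::'a::euclidean_space. inverse ((1 + norm x) ^ (2 * DIM('a))))"
proof (rule integrableI_bounded)
  have le: "inverse ((1 + norm x) ^ (2 * DIM('a))) \<le> (\<Prod>b\<in>Basis. inverse (1 + (x \<bullet> b)\<^sup>2))" for x :: 'a
  proof -
    have "(\<Prod>b\<in>(Basis::'a set). 1 + (x \<bullet> b)\<^sup>2) \<le> (\<Prod>b\<in>(Basis::'a set). (1 + norm x)\<^sup>2)"
    proof (intro prod_mono conjI)
      fix b :: 'a assume "b \<in> Basis"
      then have "(x \<bullet> b)\<^sup>2 \<le> (norm x)\<^sup>2"
        using Basis_le_norm[of b x] by (metis abs_le_square_iff abs_norm_cancel)
      moreover have "(1 + norm x)\<^sup>2 = 1 + 2 * norm x + (norm x)\<^sup>2" by (simp add: power2_eq_square algebra_simps)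
      ultimately show "1 + (x \<bullet> b)\<^sup>2 \<le> (1 + norm x)\<^sup>2" using norm_ge_zero[of x] by linarith
    qed (auto simp: add_nonneg_nonneg)
    moreover have "0 < (\<Prod>b\<in>(Basis::'a set). 1 + (x \<bullet> b)\<^sup>2)"
      by (intro prod_pos) (auto simp: add_pos_nonneg)
    ultimately show ?thesis
      using le_imp_inverse_le prod_inversef[of "\<lambda>b. 1 + (x \<bullet> b)\<^sup>2" "Basis :: 'a set"]
      by (simp add: power_mult o_def)
  qed
  have "(\<integral>\<^sup>+ x. ennreal (norm (inverse ((1 + norm (x::'a)) ^ (2 * DIM('a))))) \<partial>lborel) \<le>
      (\<integral>\<^sup>+ x. (\<Prod>b\<in>(Basis::'a set). ennreal (inverse (1 + (x \<bullet> b)\<^sup>2))) \<partial>lborel)"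
    using le by (intro nn_integral_mono) (auto simp: prod_ennreal intro!: ennreal_leI)
  also have "\<dots> = (\<Prod>b\<in>(Basis::'a set). (\<integral>\<^sup>+ t. ennreal (inverse (1 + (t::real)\<^sup>2)) \<partial>lborel))"
    by (rule nn_integral_lborel_prod) auto
  also have "\<dots> < \<infinity>"
    using integrable_inverse_1_plus_square_real
    by (auto simp: integrable_iff_bounded ennreal_prod_eq_top power_eq_top_ennreal less_top[symmetric] abs_of_nonneg)
  finally show "(\<integral>\<^sup>+ x. ennreal (norm (inverse ((1 + norm (x::'a)) ^ (2 * DIM('a))))) \<partial>lborel) < \<infinity>" .
qed auto

lemma schwartz_decay:
  fixes f :: "'a::euclidean_space \<Rightarrow> complex"
  assumes "f \<in> schwartz"
  shows "norm (f x) \<le> schwartz_seminorm N f * inverse ((1 + norm x) ^ N)"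
  using schwartz_seminorm_upper[OF assms, of "[]" N x]
  by (simp add: field_simps add_pos_nonneg)

lemma schwartz_measurable [measurable_dest]:
  "f \<in> schwartz \<Longrightarrow> f \<in> borel_measurable borel"
  by (auto simp: schwartz_iff intro: borel_measurable_continuous_onI smooth_continuous')

lemma bounded_mult_schwartz_integrable:
  fixes f g :: "'a::euclidean_space \<Rightarrow> complex"
  assumes f: "f \<in> borel_measurable borel" "\<And>x. norm (f x) \<le> B" and g: "g \<in> schwartz"
  shows "integrable lborel (\<lambda>x. f x * g x)"
proof (rule Bochner_Integration.integrable_bound)
  show "integrable lborel (\<lambda>x::'a. B * (schwartz_seminorm (2 * DIM('a)) g * inverse ((1 + norm x) ^ (2 * DIM('a)))))"
    by (intro integrable_mult_right integrable_decay)
  show "AE x in lborel. norm (f x * g x) \<le>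
      norm (B * (schwartz_seminorm (2 * DIM('a)) g * inverse ((1 + norm x) ^ (2 * DIM('a)))))"
  proof (rule AE_I2)
    fix x
    have "norm (f x * g x) \<le> B * (schwartz_seminorm (2 * DIM('a)) g * inverse ((1 + norm x) ^ (2 * DIM('a))))"
      unfolding norm_mult using order_trans[OF norm_ge_zero f(2)[of x]]
      by (intro mult_mono f schwartz_decay g) auto
    then show "norm (f x * g x) \<le> norm (B * (schwartz_seminorm (2 * DIM('a)) g * inverse ((1 + norm x) ^ (2 * DIM('a)))))"
      by simp
  qed
qed (use f schwartz_measurable[OF g] in measurable)

lemma schwartz_integrable:
  fixes g :: "'a::euclidean_space \<Rightarrow> complex"
  assumes "g \<in> schwartz"
  shows "integrable lborel g"
  using bounded_mult_schwartz_integrable[of "\<lambda>_. 1" 1 g] assms by simp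

text \<open>The decay of the Schwartz function alone makes the integral converge, at a rate given by one seminorm.\<close>

lemma tempered_regular:
  fixes f :: "'a::euclidean_space \<Rightarrow> complex"
  assumes f: "f \<in> borel_measurable borel" "\<And>x. norm (f x) \<le> B"
  shows "tempered (\<lambda>g. LINT x|lborel. f x * g x)"
proof -
  note I = bounded_mult_schwartz_integrable[OF f]
  let ?N = "2 * DIM('a)"
  let ?I = "LINT x|lborel. inverse ((1 + norm (x::'a)) ^ ?N)"
  have B: "0 \<le> B" using f(2)[of undefined] norm_ge_zero order_trans by blast
  have "norm (LINT x|lborel. f x * g x) \<le> (B * ?I) * schwartz_seminorm ?N g" if g: "g \<in> schwartz" for g
  proof -
    have "norm (LINT x|lborel. f x * g x) \<le>
        (LINT x|lborel. B * (schwartz_seminorm ?N g * inverse ((1 + norm (x::'a)) ^ ?N)))"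
    proof (rule Bochner_Integration.integral_norm_bound_integral[OF I[OF g]])
      show "integrable lborel (\<lambda>x. B * (schwartz_seminorm ?N g * inverse ((1 + norm (x::'a)) ^ ?N)))"
        by (intro integrable_mult_right integrable_decay)
      show "norm (f x * g x) \<le> B * (schwartz_seminorm ?N g * inverse ((1 + norm x) ^ ?N))" for x
        unfolding norm_mult using B by (intro mult_mono f schwartz_decay g) auto
    qed
    then show ?thesis by (simp add: mult_ac)
  qed
  then show ?thesis
    unfolding tempered_def
    by (auto simp: distrib_left I Bochner_Integration.integral_add mult.left_commute)
qed

lemma integral_lebesgue_lborel:
  fixes h :: "'a::euclidean_space \<Rightarrow> complex"
  assumes "h \<in> borel_measurable borel"
  shows "(LINT x|lebesgue. h x) = (LINT x|lborel. h x)"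
  using assms by (intro integral_completion) simp

lemma generates_regular:
  fixes f :: "'a::euclidean_space \<Rightarrow> complex"
  assumes f: "continuous_on UNIV f"
  shows "generates f S \<longleftrightarrow> (\<forall>g. test_function g \<longrightarrow> S g = (LINT x|lborel. f x * g x))"
proof -
  have "f absolutely_integrable_on K" if "compact K" for K
  proof -
    have "integrable lborel (\<lambda>x. indicator K x *\<^sub>R f x)"
      using that f by (intro borel_integrable_compact) (auto intro: continuous_on_subset)
    then show ?thesis
      by (simp add: set_integrable_def integrable_completion)
  qed
  then have "locally_integrable f"
    by (auto simp: locally_integrable_def)
  moreover have "(LINT x|lebesgue. f x * g x) = (LINT x|lborel. f x * g x)" if "test_function g" for g
    using f that by (intro integral_lebesgue_lborel borel_measurable_continuous_onI continuous_intros)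
      (auto simp: test_function_iff intro: smooth_continuous')
  ultimately show ?thesis
    by (auto simp: generates_def)
qed

lemma dyadic_generator_le:
  assumes "dyadic_generator \<phi>"
  obtains B where "B \<ge> 0" "\<And>x. \<bar>\<phi> x\<bar> \<le> B"
  using test_function_bounded[of \<phi>] assms by (auto simp: dyadic_generator_def)

text \<open>Multiplication with \<open>1 - \<phi>(x/(n+1))\<close> kills a function on the ball of radius \<open>n+1\<close>, and outside of it one
  of the powers of \<open>1 + |x|\<close> that a Schwartz function controls can be spent on a factor \<open>1/(n+1)\<close>.
  All derivatives of the cut-off function are bounded uniformly in \<open>n\<close>.\<close>

lemma cutoff_seminorm_tendsto_0:
  fixes \<phi> :: "'a::euclidean_space \<Rightarrow> real"
  assumes \<phi>: "dyadic_generator \<phi>" and f: "f \<in> schwartz"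
  shows "(\<lambda>n. schwartz_seminorm N (\<lambda>x. f x - \<phi> (inverse (real (Suc n)) *\<^sub>R x) *\<^sub>R f x)) \<longlonglongrightarrow> 0"
proof -
  have s\<phi>: "smooth \<phi>" and sf: "smooth f" using \<phi> f by (auto simp: dyadic_generator_def test_function_iff schwartz_iff)
  let ?S = "{bs\<in>lists (Basis :: 'a set). length bs \<le> N}"
  have fin: "finite ?S"
    using finite_lists_length_le[of "Basis :: 'a set" N] by (simp add: lists_eq_set)
  have "\<exists>M. \<forall>x. \<bar>mixed_deriv bs \<phi> x\<bar> \<le> M" if "bs \<in> ?S" for bs
  proof -
    have "test_function (mixed_deriv bs \<phi>)"
      using \<phi> that by (intro test_function_mixed_deriv) (auto simp: dyadic_generator_def)
    then show ?thesis
      by (rule test_function_bounded) auto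
  qed
  then obtain M where M: "\<And>bs x. bs \<in> ?S \<Longrightarrow> \<bar>mixed_deriv bs \<phi> x\<bar> \<le> M bs"
    by metis
  \<comment> \<open>The summand 1 accounts for the constant function 1 in \<open>1 - \<phi>\<close>.\<close>
  define A where "A = 1 + (\<Sum>bs\<in>?S. \<bar>M bs\<bar>)"
  define Z where "Z = schwartz_seminorm (Suc N) f"
  have Z: "0 \<le> Z"
    using schwartz_seminorm_upper[OF f, of "[]" "Suc N" 0] order_trans[OF norm_ge_zero] unfolding Z_def by auto
  have A0: "0 \<le> A" unfolding A_def by (auto intro!: add_nonneg_nonneg sum_nonneg)
  have le: "schwartz_seminorm N (\<lambda>x. f x - \<phi> (inverse (real (Suc n)) *\<^sub>R x) *\<^sub>R f x)
      \<le> 2 ^ N * (A * Z) * inverse (real (Suc n))" for n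
  proof (rule schwartz_seminorm_least)
    fix bs :: "'a list" and x :: 'a
    assume bs: "bs \<in> lists Basis" "length bs \<le> N"
    let ?c = "inverse (real (Suc n))"
    define a where "a = (\<lambda>x. 1 - \<phi> (?c *\<^sub>R x + 0))"
    have sa: "smooth a"
      unfolding a_def by (rule smooth_diff[OF _ smooth_affine[OF s\<phi>]]) (use smooth_inner[of 1 "0::'a"] in simp)
    have eq: "(\<lambda>x. f x - \<phi> (?c *\<^sub>R x) *\<^sub>R f x) = (\<lambda>x. a x *\<^sub>R f x)"
      by (simp add: a_def scaleR_left_diff_distrib)
    show "(1 + norm x) ^ N * norm (mixed_deriv bs (\<lambda>x. f x - \<phi> (?c *\<^sub>R x) *\<^sub>R f x) x)
        \<le> 2 ^ N * (A * Z) * ?c"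
    proof (cases "norm x < real (Suc n)")
      case True
      have "mixed_deriv bs (\<lambda>x. a x *\<^sub>R f x) x = 0"
      proof (rule mixed_deriv_eq_0_on_open)
        show "open (ball (0::'a) (Suc n))" by simp
        show "a y *\<^sub>R f y = 0" if "y \<in> ball 0 (real (Suc n))" for y
        proof -
          have "norm (?c *\<^sub>R y) \<le> 1" using that by (simp add: field_simps)
          then have "\<phi> (?c *\<^sub>R y) = 1"
            using \<phi> unfolding dyadic_generator_def by blast
          then show ?thesis by (simp add: a_def)
        qed
      qed (use True in simp)
      then show ?thesis
        unfolding eq using A0 Z by simp
    next
      case False
      have "\<bar>mixed_deriv cs a x\<bar> \<le> A" if cs: "cs \<in> lists Basis" "length cs \<le> length bs" for cs
      proof -
        have *: "cs \<in> ?S" using cs bs by auto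
        have 1: "mixed_deriv cs a x = mixed_deriv cs (\<lambda>_. 1) x - ?c ^ length cs *\<^sub>R mixed_deriv cs \<phi> (?c *\<^sub>R x + 0)"
          unfolding a_def
          by (subst mixed_deriv_diff[OF _ smooth_affine[OF s\<phi>] cs(1)])
            (use smooth_inner[of 1 "0::'a"] mixed_deriv_affine[OF s\<phi> cs(1), of ?c 0] in simp_all)
        have 2: "\<bar>mixed_deriv cs (\<lambda>_::'a. 1::real) x\<bar> \<le> 1"
          by (cases "cs = []") (auto simp: mixed_deriv_const)
        have "?c ^ length cs \<le> 1" by (intro power_le_one) (auto simp: field_simps)
        moreover have "\<bar>mixed_deriv cs \<phi> (?c *\<^sub>R x + 0)\<bar> \<le> \<bar>M cs\<bar>" using M[OF *, of "?c *\<^sub>R x + 0"] by linarith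
        ultimately have "\<bar>?c ^ length cs *\<^sub>R mixed_deriv cs \<phi> (?c *\<^sub>R x + 0)\<bar> \<le> 1 * \<bar>M cs\<bar>"
          unfolding real_scaleR_def abs_mult by (intro mult_mono) auto
        also have "\<dots> \<le> (\<Sum>bs\<in>?S. \<bar>M bs\<bar>)" unfolding mult_1 by (rule member_le_sum[OF *]) (auto simp: fin)
        finally show ?thesis unfolding 1 A_def using 2 by linarith
      qed
      moreover have "norm (mixed_deriv ds f x) \<le> Z * inverse ((1 + norm x) ^ Suc N)"
        if ds: "ds \<in> lists Basis" "length ds \<le> length bs" for ds
        using schwartz_seminorm_upper[OF f ds(1), of "Suc N" x] ds(2) bs(2)
        unfolding Z_def by (simp add: field_simps add_pos_nonneg)
      ultimately have "norm (mixed_deriv bs (\<lambda>x. a x *\<^sub>R f x) x) \<le> 2 ^ length bs * (A * (Z * inverse ((1 + norm x) ^ Suc N)))"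
        by (intro mixed_deriv_scaleR_le sa sf bs(1)) auto
      also have "\<dots> \<le> 2 ^ N * (A * (Z * inverse ((1 + norm x) ^ Suc N)))"
        using bs(2) A0 Z by (intro mult_right_mono power_increasing) auto
      finally have "(1 + norm x) ^ N * norm (mixed_deriv bs (\<lambda>x. a x *\<^sub>R f x) x) \<le>
          (1 + norm x) ^ N * (2 ^ N * (A * (Z * inverse ((1 + norm x) ^ Suc N))))"
        by (intro mult_left_mono) auto
      also have "\<dots> = 2 ^ N * (A * Z) * inverse (1 + norm x)"
      proof -
        have "(1 + norm x) ^ N * inverse ((1 + norm x) ^ Suc N) = inverse (1 + norm x)"
        proof -
          have "0 < 1 + norm x" using norm_ge_zero[of x] by linarith
          then show ?thesis by (simp add: nonzero_inverse_mult_distrib)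
        qed
        then show ?thesis by (metis (no_types, opaque_lifting) mult.assoc mult.left_commute)
      qed
      also have "\<dots> \<le> 2 ^ N * (A * Z) * ?c"
        using False A0 Z by (intro mult_left_mono le_imp_inverse_le) auto
      finally show ?thesis unfolding eq .
    qed
  qed
  have nn: "0 \<le> schwartz_seminorm N (\<lambda>x. f x - \<phi> (inverse (real (Suc n)) *\<^sub>R x) *\<^sub>R f x)" for n
  proof -
    have "test_function (\<lambda>x. \<phi> (inverse (real (Suc n)) *\<^sub>R x + 0) *\<^sub>R f x)"
      using \<phi> by (intro test_function_scaleR smooth_affine s\<phi> sf disjI1 test_function_affine) (auto simp: dyadic_generator_def)
    then have "(\<lambda>x. f x - \<phi> (inverse (real (Suc n)) *\<^sub>R x) *\<^sub>R f x) \<in> schwartz"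
      by (intro schwartz_diff f test_function_schwartz) auto
    from schwartz_seminorm_upper[OF this, of "[]" N 0] show ?thesis
      using order_trans[OF norm_ge_zero] by auto
  qed
  have lim: "(\<lambda>n. 2 ^ N * (A * Z) * inverse (real (Suc n))) \<longlonglongrightarrow> 0"
    by (rule tendsto_mult_right_zero[OF LIMSEQ_inverse_real_of_nat])
  show ?thesis
  proof (rule tendsto_sandwich[OF _ _ tendsto_const lim])
    show "eventually (\<lambda>n. 0 \<le> schwartz_seminorm N (\<lambda>x. f x - \<phi> (inverse (real (Suc n)) *\<^sub>R x) *\<^sub>R f x)) sequentially"
      by (rule always_eventually, rule allI, rule nn)
    show "eventually (\<lambda>n. schwartz_seminorm N (\<lambda>x. f x - \<phi> (inverse (real (Suc n)) *\<^sub>R x) *\<^sub>R f x)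
        \<le> 2 ^ N * (A * Z) * inverse (real (Suc n))) sequentially"
      by (rule always_eventually, rule allI, rule le)
  qed
qed

text \<open>A distribution generated by a function is prescribed on compactly supported functions only. By density
  this determines a tempered distribution on all Schwartz functions, and for bounded \<open>f\<close> it is again given by
  the integral. This is needed because the Fourier transform destroys compact supports, so that the
  Littlewood--Paley blocks evaluate the distribution off the compactly supported functions.\<close>

lemma tempered_generates_schwartz:
  fixes f :: "'a::euclidean_space \<Rightarrow> complex"
  assumes \<phi>: "dyadic_generator (\<phi> :: 'a \<Rightarrow> real)" and T: "tempered T" "generates f T"
    and f: "continuous_on UNIV f" "\<And>x. norm (f x) \<le> B" and g: "g \<in> schwartz"
  shows "T g = (LINT x|lborel. f x * g x)"
proof -
  define t where "t = (\<lambda>n x. \<phi> (inverse (real (Suc n)) *\<^sub>R x) *\<^sub>R g x)"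
  have sg: "smooth g" "smooth \<phi>" using g \<phi> by (auto simp: schwartz_iff dyadic_generator_def test_function_iff)
  have tt: "test_function (t n)" for n
  proof -
    have "test_function (\<lambda>x. \<phi> (inverse (real (Suc n)) *\<^sub>R x + 0) *\<^sub>R g x)"
      using \<phi> by (intro test_function_scaleR smooth_affine sg disjI1 test_function_affine) (auto simp: dyadic_generator_def)
    then show ?thesis by (simp add: t_def)
  qed
  then have ts: "t n \<in> schwartz" for n
    by (rule test_function_schwartz)
  obtain N C where C: "\<And>h. h \<in> schwartz \<Longrightarrow> norm (T h) \<le> C * schwartz_seminorm N h"
    using T(1) unfolding tempered_def by blast
  have fm: "f \<in> borel_measurable borel" using f(1) by (rule borel_measurable_continuous_onI)
  have B: "0 \<le> B" using f(2)[of undefined] norm_ge_zero order_trans by blast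
  have "(\<lambda>n. C * schwartz_seminorm N (\<lambda>x. g x - t n x)) \<longlonglongrightarrow> 0"
    unfolding t_def by (intro tendsto_mult_right_zero cutoff_seminorm_tendsto_0 \<phi> g)
  then have 1: "(\<lambda>n. T (\<lambda>x. g x - t n x)) \<longlonglongrightarrow> 0"
    by (rule Lim_null_comparison[rotated]) (auto intro!: always_eventually C schwartz_diff g ts)
  obtain K where K: "K \<ge> 0" "\<And>x. \<bar>\<phi> x\<bar> \<le> K"
    using dyadic_generator_le[OF \<phi>] by blast
  have 2: "(\<lambda>n. LINT x|lborel. f x * t n x) \<longlonglongrightarrow> (LINT x|lborel. f x * g x)"
  proof (rule integral_dominated_convergence)
    show "integrable lborel (\<lambda>x. B * K * norm (g x))"
      by (intro integrable_mult_right integrable_norm schwartz_integrable g)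
    show "AE x in lborel. norm (f x * t n x) \<le> B * K * norm (g x)" for n
      using f(2) K B unfolding t_def norm_mult norm_scaleR mult.assoc
      by (intro AE_I2 mult_mono) auto
    show "AE x in lborel. (\<lambda>n. f x * t n x) \<longlonglongrightarrow> f x * g x"
    proof (rule AE_I2)
      fix x :: 'a
      have "eventually (\<lambda>n. norm x \<le> real (Suc n)) sequentially"
        using filterlim_real_sequentially unfolding filterlim_at_top
        by (rule allE[of _ "norm x"]) (auto elim!: eventually_mono)
      then have "eventually (\<lambda>n. f x * g x = f x * t n x) sequentially"
      proof eventually_elim
        case (elim n)
        then have "norm (inverse (real (Suc n)) *\<^sub>R x) \<le> 1" by (simp add: field_simps)
        then have "\<phi> (inverse (real (Suc n)) *\<^sub>R x) = 1" using \<phi> unfolding dyadic_generator_def by blast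
        then show ?case by (simp add: t_def)
      qed
      then show "(\<lambda>n. f x * t n x) \<longlonglongrightarrow> f x * g x"
        by (rule Lim_transform_eventually[OF tendsto_const])
    qed
  qed (use fm schwartz_measurable[OF g] schwartz_measurable[OF ts] in measurable)
  have "T g = T (\<lambda>x. g x - t n x) + (LINT x|lborel. f x * t n x)" for n
  proof -
    have "T g = T (\<lambda>x. (g x - t n x) + t n x)" by simp
    also have "\<dots> = T (\<lambda>x. g x - t n x) + T (t n)"
      using conjunct1[OF T(1)[unfolded tempered_def], rule_format, OF schwartz_diff[OF g ts] ts] .
    also have "T (t n) = (LINT x|lborel. f x * t n x)"
      using T(2) tt unfolding generates_regular[OF f(1)] by blast
    finally show ?thesis .
  qed
  then have "(\<lambda>n. T g) \<longlonglongrightarrow> 0 + (LINT x|lborel. f x * g x)"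
    using tendsto_add[OF 1 2] by simp
  then show ?thesis
    by (simp add: LIMSEQ_const_iff)
qed

section \<open>Fourier transforms of test functions\<close>

lemma measurable_cis [measurable]: "cis \<in> borel_measurable borel"
  by (intro borel_measurable_continuous_onI continuous_intros)

lemma integrable_cis_mult:
  fixes g :: "'a \<Rightarrow> complex"
  assumes "h \<in> borel_measurable M" "integrable M g"
  shows "integrable M (\<lambda>x. cis (h x) * g x)"
  by (rule Bochner_Integration.integrable_bound[OF assms(2)]) (use assms in \<open>auto simp: norm_mult\<close>)

text \<open>In the applications the kernel is an exponential of modulus 1, so integrability on the product space
  reduces to that of \<open>a(x) b(y)\<close>.\<close>

lemma Fubini_bounded_kernel:
  fixes a :: "'a \<Rightarrow> complex" and b :: "'b \<Rightarrow> complex" and k :: "'a \<Rightarrow> 'b \<Rightarrow> complex"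
  assumes "sigma_finite_measure M" "sigma_finite_measure N"
    and a: "integrable M a" and b: "integrable N b"
    and k [measurable]: "case_prod k \<in> borel_measurable (M \<Otimes>\<^sub>M N)" and k1: "\<And>x y. norm (k x y) \<le> 1"
  shows "(LINT x|M. a x * (LINT y|N. k x y * b y)) = (LINT y|N. (LINT x|M. a x * k x y) * b y)"
proof -
  interpret M: sigma_finite_measure M by fact
  interpret N: sigma_finite_measure N by fact
  interpret pair_sigma_finite M N ..
  have [measurable]: "a \<in> borel_measurable M" "b \<in> borel_measurable N"
    using a b by auto
  have bound: "norm (a x * k x y * b y) \<le> norm (a x) * norm (b y)" for x y
    unfolding norm_mult by (intro mult_right_mono) (auto intro: mult_left_le k1)
  have I: "integrable (M \<Otimes>\<^sub>M N) (\<lambda>(x, y). a x * k x y * b y)"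
  proof (rule Fubini_integrable)
    have ky: "integrable N (\<lambda>y. norm (a x * k x y * b y))" if "x \<in> space M" for x
    proof (rule Bochner_Integration.integrable_bound)
      show "integrable N (\<lambda>y. norm (a x) * norm (b y))"
        by (intro integrable_mult_right integrable_norm b)
      show "AE y in N. norm (norm (a x * k x y * b y)) \<le> norm (norm (a x) * norm (b y))"
        using bound by (intro AE_I2) simp
    qed (use that in measurable)
    show "integrable M (\<lambda>x. LINT y|N. norm (case (x, y) of (x, y) \<Rightarrow> a x * k x y * b y))"
    proof (rule Bochner_Integration.integrable_bound)
      show "integrable M (\<lambda>x. norm (a x) * (LINT y|N. norm (b y)))"
        by (intro integrable_mult_left integrable_norm a)
      show "AE x in M. norm (LINT y|N. norm (case (x, y) of (x, y) \<Rightarrow> a x * k x y * b y))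
          \<le> norm (norm (a x) * (LINT y|N. norm (b y)))"
      proof (rule AE_I2)
        fix x assume x: "x \<in> space M"
        have "(LINT y|N. norm (a x * k x y * b y)) \<le> (LINT y|N. norm (a x) * norm (b y))"
          by (intro integral_mono ky x integrable_mult_right integrable_norm b bound)
        then show "norm (LINT y|N. norm (case (x, y) of (x, y) \<Rightarrow> a x * k x y * b y))
          \<le> norm (norm (a x) * (LINT y|N. norm (b y)))"
          by (simp add: abs_of_nonneg integral_nonneg_AE)
      qed
    qed measurable
    show "AE x in M. integrable N (\<lambda>y. case (x, y) of (x, y) \<Rightarrow> a x * k x y * b y)"
    proof (rule AE_I2)
      fix x assume x: "x \<in> space M"
      have "(\<lambda>y. a x * k x y * b y) \<in> borel_measurable N" using x by measurable
      then show "integrable N (\<lambda>y. case (x, y) of (x, y) \<Rightarrow> a x * k x y * b y)"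
        using ky[OF x] by (simp add: integrable_norm_iff)
    qed
  qed measurable
  have "(LINT x|M. a x * (LINT y|N. k x y * b y)) = (LINT x|M. LINT y|N. a x * k x y * b y)"
    by (simp add: mult.assoc)
  also have "\<dots> = (LINT y|N. LINT x|M. a x * k x y * b y)"
    using Fubini_integral[of "\<lambda>x y. a x * k x y * b y"] I by simp
  also have "\<dots> = (LINT y|N. (LINT x|M. a x * k x y) * b y)"
    by simp
  finally show ?thesis .
qed

lemma norm_fourier_le:
  fixes g :: "'a::euclidean_space \<Rightarrow> complex"
  assumes "integrable lborel g"
  shows "norm (fourier g \<xi>) \<le> (2 * pi) powr (- real DIM('a) / 2) * (LINT x|lborel. norm (g x))"
proof -
  have "norm (LINT x|lborel. cis (- (x \<bullet> \<xi>)) * g x) \<le> (LINT x|lborel. norm (cis (- (x \<bullet> \<xi>)) * g x))"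
    by (rule integral_norm_bound)
  then show ?thesis
    unfolding fourier_def by (simp add: norm_mult mult_left_mono)
qed

text \<open>A quadratic error is integrable against a function of compact support, and so it allows differentiation under
  the Fourier integral.\<close>

lemma norm_cis_minus_linear_le: "norm (cis t - 1 - \<i> * of_real t) \<le> t\<^sup>2"
proof -
  have "norm (iexp t - (\<Sum>k\<le>1. (\<i> * t) ^ k / fact k)) \<le> \<bar>t\<bar> ^ Suc 1 / fact (Suc 1)"
    by (rule iexp_approx1)
  then have "norm (cis t - 1 - \<i> * of_real t) \<le> t\<^sup>2 / 2"
    by (simp add: cis_conv_exp algebra_simps power2_eq_square)
  then show ?thesis
    by (rule order_trans) simp
qed

lemma test_function_coordinate_mult:
  fixes g :: "'a::euclidean_space \<Rightarrow> complex"
  assumes "test_function g"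
  shows "test_function (\<lambda>x. (x \<bullet> b) *\<^sub>R (- \<i> * g x))"
proof -
  have t: "test_function (\<lambda>x. - \<i> * g x)"
    by (rule test_function_bounded_linear[OF bounded_linear_mult_right assms])
  then have "smooth (\<lambda>x. - \<i> * g x)" by (simp add: test_function_iff)
  from test_function_scaleR[OF smooth_inner[of 0 b] this disjI2[OF t]] show ?thesis
    by simp
qed

lemma fourier_has_derivative:
  fixes g :: "'a::euclidean_space \<Rightarrow> complex"
  assumes g: "test_function g"
  shows "(fourier g has_derivative (\<lambda>h. fourier (\<lambda>x. (x \<bullet> h) *\<^sub>R (- \<i> * g x)) \<xi>)) (at \<xi>)"
proof -
  let ?c = "(2 * pi) powr (- real DIM('a) / 2)"
  have sg: "smooth g" using g by (simp add: test_function_iff)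
  have ig: "integrable lborel (\<lambda>x. (x \<bullet> h) *\<^sub>R (- \<i> * g x))" for h
    by (rule test_function_integrable[OF test_function_coordinate_mult[OF g]])
  note ic = integrable_cis_mult[OF _ ig]
  have gi: "integrable lborel g" by (rule test_function_integrable[OF g])
  have [measurable]: "g \<in> borel_measurable borel" using gi by auto
  obtain R where R: "\<forall>x. R < norm x \<longrightarrow> g x = 0" using g by (auto simp: test_function_iff)
  have R': "norm x * norm (g x) \<le> \<bar>R\<bar> * norm (g x)" for x
    using R by (cases "R < norm x") (auto intro: mult_right_mono)
  have R2: "(norm x)\<^sup>2 * norm (g x) \<le> \<bar>R\<bar>\<^sup>2 * norm (g x)" for x
    using R by (cases "R < norm x") (auto intro!: mult_right_mono simp: abs_le_square_iff[symmetric])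
  let ?I = "LINT x|lborel. norm (g x)"
  let ?D = "\<lambda>h. fourier (\<lambda>x. (x \<bullet> h) *\<^sub>R (- \<i> * g x)) \<xi>"
  show ?thesis
  proof (rule has_derivativeI_sandwich[where e = 1])
    show "bounded_linear ?D"
    proof (rule bounded_linear_intro[where K = "?c * (\<bar>R\<bar> * ?I)"])
      show "?D (h + k) = ?D h + ?D k" for h k
      proof -
        have "(LINT x|lborel. cis (- (x \<bullet> \<xi>)) * (x \<bullet> (h + k)) *\<^sub>R (- \<i> * g x)) =
            (LINT x|lborel. cis (- (x \<bullet> \<xi>)) * (x \<bullet> h) *\<^sub>R (- \<i> * g x)
              + cis (- (x \<bullet> \<xi>)) * (x \<bullet> k) *\<^sub>R (- \<i> * g x))"
          by (intro Bochner_Integration.integral_cong refl)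
            (simp only: inner_add_right scaleR_add_left distrib_left)
        also have "\<dots> = (LINT x|lborel. cis (- (x \<bullet> \<xi>)) * (x \<bullet> h) *\<^sub>R (- \<i> * g x))
              + (LINT x|lborel. cis (- (x \<bullet> \<xi>)) * (x \<bullet> k) *\<^sub>R (- \<i> * g x))"
          by (intro Bochner_Integration.integral_add ic) measurable
        finally show ?thesis
          unfolding fourier_def by (simp only: scaleR_add_right)
      qed
      show "?D (r *\<^sub>R h) = r *\<^sub>R ?D h" for r h
        unfolding fourier_def by (simp flip: scaleR_scaleR) (simp add: mult.commute)
      show "norm (?D h) \<le> norm h * (?c * (\<bar>R\<bar> * ?I))" for h
      proof -
        have "(LINT x|lborel. norm ((x \<bullet> h) *\<^sub>R (- \<i> * g x))) \<le> (LINT x|lborel. norm h * (\<bar>R\<bar> * norm (g x)))"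
        proof (intro integral_mono integrable_norm ig integrable_mult_right gi)
          fix x
          have "norm ((x \<bullet> h) *\<^sub>R (- \<i> * g x)) \<le> (norm x * norm h) * norm (g x)"
            by (auto simp: norm_mult intro!: mult_right_mono Cauchy_Schwarz_ineq2)
          also have "\<dots> = norm h * (norm x * norm (g x))" by (simp add: mult_ac)
          also have "\<dots> \<le> norm h * (\<bar>R\<bar> * norm (g x))" by (intro mult_left_mono R') auto
          finally show "norm ((x \<bullet> h) *\<^sub>R (- \<i> * g x)) \<le> norm h * (\<bar>R\<bar> * norm (g x))" .
        qed
        also have "\<dots> = norm h * (\<bar>R\<bar> * ?I)" by simp
        finally have "?c * (LINT x|lborel. norm ((x \<bullet> h) *\<^sub>R (- \<i> * g x))) \<le> ?c * (norm h * (\<bar>R\<bar> * ?I))"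
          by (intro mult_left_mono) auto
        then show ?thesis
          using order_trans[OF norm_fourier_le[OF ig[of h], of \<xi>]] by (simp only: mult_ac)
      qed
    qed
    show "norm ((fourier g y - fourier g \<xi>) - ?D (y - \<xi>)) / norm (y - \<xi>) \<le> ?c * (\<bar>R\<bar>\<^sup>2 * ?I) * norm (y - \<xi>)"
      if "y \<noteq> \<xi>" for y
    proof -
      define h where "h = y - \<xi>"
      have y: "y = \<xi> + h" and h: "h \<noteq> 0" using that by (auto simp: h_def)
      let ?f = "\<lambda>x. cis (- (x \<bullet> \<xi>)) * (cis (- (x \<bullet> h)) - 1 - \<i> * of_real (- (x \<bullet> h))) * g x"
      have 1: "(fourier g y - fourier g \<xi>) - ?D h = ?c *\<^sub>R (LINT x|lborel. ?f x)"
      proof -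
        have "(LINT x|lborel. ?f x) = (LINT x|lborel. (cis (- (x \<bullet> y)) * g x - cis (- (x \<bullet> \<xi>)) * g x) -
            cis (- (x \<bullet> \<xi>)) * (x \<bullet> h) *\<^sub>R (- \<i> * g x))"
        proof (intro Bochner_Integration.integral_cong refl)
          fix x
          have e: "cis (- (x \<bullet> y)) = cis (- (x \<bullet> \<xi>)) * cis (- (x \<bullet> h))"
            by (simp add: y inner_add_right cis_mult)
          show "?f x = (cis (- (x \<bullet> y)) * g x - cis (- (x \<bullet> \<xi>)) * g x) -
            cis (- (x \<bullet> \<xi>)) * (x \<bullet> h) *\<^sub>R (- \<i> * g x)"
            unfolding e scaleR_conv_of_real by (simp add: algebra_simps del: cis_mult)
        qed
        also have "\<dots> = (LINT x|lborel. cis (- (x \<bullet> y)) * g x) - (LINT x|lborel. cis (- (x \<bullet> \<xi>)) * g x) -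
            (LINT x|lborel. cis (- (x \<bullet> \<xi>)) * (x \<bullet> h) *\<^sub>R (- \<i> * g x))"
          using ic[of "\<lambda>x. - (x \<bullet> \<xi>)" h] integrable_cis_mult[OF _ gi]
          by (subst Bochner_Integration.integral_diff | simp)+
        finally show ?thesis
          unfolding fourier_def by (simp only: scaleR_diff_right)
      qed
      have "norm (LINT x|lborel. ?f x) \<le> (LINT x|lborel. (norm h)\<^sup>2 * (\<bar>R\<bar>\<^sup>2 * norm (g x)))"
      proof (rule order_trans[OF integral_norm_bound integral_mono_AE'])
        show "integrable lborel (\<lambda>x. (norm h)\<^sup>2 * (\<bar>R\<bar>\<^sup>2 * norm (g x)))"
          by (intro integrable_mult_right integrable_norm gi)
        show "AE x in lborel. norm (?f x) \<le> (norm h)\<^sup>2 * (\<bar>R\<bar>\<^sup>2 * norm (g x))"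
        proof (rule AE_I2)
          fix x
          have "norm (cis (- (x \<bullet> h)) - 1 - \<i> * of_real (- (x \<bullet> h))) \<le> (x \<bullet> h)\<^sup>2"
            using norm_cis_minus_linear_le[of "- (x \<bullet> h)"] by (simp only: power2_minus)
          also have "\<dots> \<le> (norm x * norm h)\<^sup>2"
            using Cauchy_Schwarz_ineq2[of x h] by (simp add: abs_le_square_iff[symmetric])
          finally have "norm (?f x) \<le> (norm x * norm h)\<^sup>2 * norm (g x)"
            unfolding norm_mult norm_cis mult_1 by (intro mult_right_mono) auto
          also have "\<dots> = (norm h)\<^sup>2 * ((norm x)\<^sup>2 * norm (g x))" by (simp add: power_mult_distrib)
          also have "\<dots> \<le> (norm h)\<^sup>2 * (\<bar>R\<bar>\<^sup>2 * norm (g x))" by (intro mult_left_mono R2) auto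
          finally show "norm (?f x) \<le> (norm h)\<^sup>2 * (\<bar>R\<bar>\<^sup>2 * norm (g x))" .
        qed
      qed auto
      then have "norm ((fourier g y - fourier g \<xi>) - ?D h) \<le> ?c * ((norm h)\<^sup>2 * (\<bar>R\<bar>\<^sup>2 * ?I))"
        unfolding 1 by (simp add: mult_left_mono)
      then show ?thesis
        using h by (simp add: h_def[symmetric] divide_simps power2_eq_square mult_ac)
    qed
    have "((\<lambda>y. ?c * (\<bar>R\<bar>\<^sup>2 * ?I) * norm (y - \<xi>)) \<longlongrightarrow> ?c * (\<bar>R\<bar>\<^sup>2 * ?I) * norm (\<xi> - \<xi>)) (at \<xi>)"
      by (intro tendsto_intros)
    then show "((\<lambda>y. ?c * (\<bar>R\<bar>\<^sup>2 * ?I) * norm (y - \<xi>)) \<longlongrightarrow> 0) (at \<xi>)"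
      by simp
  qed auto
qed

lemma partial_deriv_fourier:
  fixes g :: "'a::euclidean_space \<Rightarrow> complex"
  assumes "test_function g"
  shows "partial_deriv b (fourier g) = fourier (\<lambda>x. (x \<bullet> b) *\<^sub>R (- \<i> * g x))"
  by (rule ext, rule partial_deriv_eq[OF fourier_has_derivative[OF assms]])

lemma mixed_deriv_fourier:
  fixes g :: "'a::euclidean_space \<Rightarrow> complex"
  assumes "test_function g"
  shows "\<exists>g'. test_function g' \<and> mixed_deriv bs (fourier g) = fourier g'"
proof (induction bs)
  case (Cons b bs)
  then show ?case
    using partial_deriv_fourier test_function_coordinate_mult by fastforce
qed (use assms in auto)

lemma smooth_fourier:
  fixes g :: "'a::euclidean_space \<Rightarrow> complex"
  assumes "test_function g"
  shows "smooth (fourier g)"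
  unfolding smooth_def
proof
  fix bs :: "'a list"
  obtain g' where "test_function g'" "mixed_deriv bs (fourier g) = fourier g'"
    using mixed_deriv_fourier[OF assms] by blast
  then show "mixed_deriv bs (fourier g) differentiable_on UNIV"
    using fourier_has_derivative[of g'] by (auto simp: differentiable_on_def differentiable_def)
qed

lemma lborel_integral_translate:
  fixes h :: "'a::euclidean_space \<Rightarrow> complex"
  assumes [measurable]: "h \<in> borel_measurable borel"
  shows "(LINT x|lborel. h (v + x)) = (LINT x|lborel. h x)"
proof -
  have "(LINT x|lborel. h x) = (LINT x|distr lborel borel ((+) v). h x)"
    by (simp add: lborel_distr_plus)
  also have "\<dots> = (LINT x|lborel. h (v + x))"
    by (rule integral_distr) auto
  finally show ?thesis by simp
qed

text \<open>Instead of integrating by parts, compare the Fourier transforms of difference quotients: translation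
  by \<open>t b\<close> multiplies the Fourier transform by \<open>cis (t * (b \<bullet> \<xi>))\<close>, and both sides converge for \<open>t \<longlonglongrightarrow> 0\<close>.\<close>

lemma fourier_partial_deriv:
  fixes g :: "'a::euclidean_space \<Rightarrow> complex"
  assumes g: "test_function g" and b: "b \<in> Basis"
  shows "fourier (partial_deriv b g) \<xi> = \<i> * of_real (b \<bullet> \<xi>) * fourier g \<xi>"
proof -
  have sg: "smooth g" using g by (simp add: test_function_iff)
  have gi: "integrable lborel g" by (rule test_function_integrable[OF g])
  have [measurable]: "g \<in> borel_measurable borel" using gi by auto
  obtain R where R: "\<forall>x. R < norm x \<longrightarrow> g x = 0" using g by (auto simp: test_function_iff)
  have tp: "test_function (partial_deriv b g)"
    using test_function_mixed_deriv[OF g, of "[b]"] b by simp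
  obtain M where M: "M \<ge> 0" "\<And>x. norm (partial_deriv b g x) \<le> M"
    using test_function_bounded[OF tp] by blast
  define t where "t n = inverse (real (Suc n))" for n
  have t: "0 < t n" "t n \<le> 1" for n by (auto simp: t_def field_simps)
  have t0: "t \<longlonglongrightarrow> 0" unfolding t_def by (rule LIMSEQ_inverse_real_of_nat)
  define q where "q n x = inverse (t n) *\<^sub>R (g (t n *\<^sub>R b + x) - g x)" for n x
  have dv: "((\<lambda>s. g (x + s *\<^sub>R b)) has_derivative (\<lambda>h. h *\<^sub>R partial_deriv b g (x + s *\<^sub>R b))) (at s)" for x s
  proof -
    let ?D = "frechet_derivative g (at (x + s *\<^sub>R b))"
    have D: "(g has_derivative ?D) (at (x + s *\<^sub>R b))" by (rule smooth_has_derivative'[OF sg])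
    have "((\<lambda>s. g (x + s *\<^sub>R b)) has_derivative (\<lambda>h. ?D (h *\<^sub>R b))) (at s)"
      by (rule has_derivative_compose[where f = "\<lambda>s. x + s *\<^sub>R b", OF _ D]) (auto intro!: derivative_eq_intros)
    then show ?thesis
      using linear_scale[OF has_derivative_linear[OF D]] by (simp add: partial_deriv_def)
  qed
  \<comment> \<open>Mean value inequality: the difference quotients have a common bound, needed for dominated convergence.\<close>
  have q_le: "norm (q n x) \<le> M" for n x
  proof -
    have "norm (g (x + t n *\<^sub>R b) - g (x + 0 *\<^sub>R b)) \<le> M * norm (t n - 0)"
    proof (rule differentiable_bound[where S = UNIV and f = "\<lambda>s. g (x + s *\<^sub>R b)"])
      show "onorm (\<lambda>h. h *\<^sub>R partial_deriv b g (x + s *\<^sub>R b)) \<le> M" for s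
        using M by (intro onorm_le) (auto simp: mult.commute[of _ M] mult.commute[of "\<bar>_\<bar>"] intro!: mult_right_mono)
    qed (use dv in auto)
    then show ?thesis
      using t(1)[of n] by (simp add: q_def add.commute divide_simps inverse_eq_divide)
  qed
  have q_lim: "(\<lambda>n. q n x) \<longlonglongrightarrow> partial_deriv b g x" for x
  proof -
    let ?v = "partial_deriv b g x"
    have "((\<lambda>s. norm (g (x + s *\<^sub>R b) - g x - s *\<^sub>R ?v) / norm s) \<longlongrightarrow> 0) (at 0)"
      using dv[of x 0] by (simp add: has_derivative_iff_norm)
    moreover have "norm (g (x + s *\<^sub>R b) - g x - s *\<^sub>R ?v) / norm s = norm ((g (x + s *\<^sub>R b) - g x) /\<^sub>R s - ?v)"
      if "s \<noteq> 0" for s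
    proof -
      have "(g (x + s *\<^sub>R b) - g x) /\<^sub>R s - ?v = (g (x + s *\<^sub>R b) - g x - s *\<^sub>R ?v) /\<^sub>R s"
        using that by (simp add: scaleR_diff_right)
      then show ?thesis by (simp add: divide_inverse mult.commute)
    qed
    ultimately have "((\<lambda>s. norm ((g (x + s *\<^sub>R b) - g x) /\<^sub>R s - ?v)) \<longlongrightarrow> 0) (at 0)"
      by (elim Lim_transform_eventually) (auto simp: eventually_at_filter)
    then have *: "((\<lambda>s. (g (x + s *\<^sub>R b) - g x) /\<^sub>R s) \<longlongrightarrow> ?v) (at 0)"
      by (rule tendsto_norm_zero_cancel[THEN LIM_zero_cancel])
    have "filterlim t (at 0) sequentially"
      unfolding filterlim_at using t(1) t0 by (auto intro!: always_eventually simp: less_imp_neq[symmetric])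
    from filterlim_compose[OF * this] show ?thesis
      by (simp add: q_def add.commute)
  qed
  have lim: "(\<lambda>n. LINT x|lborel. cis (- (x \<bullet> \<xi>)) * q n x) \<longlonglongrightarrow>
      (LINT x|lborel. cis (- (x \<bullet> \<xi>)) * partial_deriv b g x)"
  proof (rule integral_dominated_convergence)
    show "integrable lborel (\<lambda>x::'a. indicator (cball 0 (\<bar>R\<bar> + 1)) x *\<^sub>R M)"
      by (intro borel_integrable_compact) auto
    show "AE x in lborel. (\<lambda>n. cis (- (x \<bullet> \<xi>)) * q n x) \<longlonglongrightarrow> cis (- (x \<bullet> \<xi>)) * partial_deriv b g x"
      by (intro AE_I2 tendsto_intros q_lim)
    show "AE x in lborel. norm (cis (- (x \<bullet> \<xi>)) * q n x) \<le> indicator (cball 0 (\<bar>R\<bar> + 1)) x *\<^sub>R M" for n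
    proof (rule AE_I2)
      fix x
      show "norm (cis (- (x \<bullet> \<xi>)) * q n x) \<le> indicator (cball 0 (\<bar>R\<bar> + 1)) x *\<^sub>R M"
      proof (cases "norm x \<le> \<bar>R\<bar> + 1")
        case True
        then show ?thesis using q_le by (simp add: norm_mult)
      next
        case False
        have "norm x \<le> norm (t n *\<^sub>R b + x) + norm (t n *\<^sub>R b)"
          using norm_triangle_ineq4[of "t n *\<^sub>R b + x" "t n *\<^sub>R b"] by simp
        moreover have "norm (t n *\<^sub>R b) \<le> 1" using t[of n] b by simp
        ultimately have "R < norm (t n *\<^sub>R b + x)" "R < norm x" using False by auto
        then show ?thesis using R M(1) by (simp add: q_def indicator_def)
      qed
    qed
    show "(\<lambda>x. cis (- (x \<bullet> \<xi>)) * partial_deriv b g x) \<in> borel_measurable lborel"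
      using test_function_integrable[OF tp] by simp
  qed (auto simp: q_def)
  define J where "J = (LINT x|lborel. cis (- (x \<bullet> \<xi>)) * g x)"
  have qJ: "(LINT x|lborel. cis (- (x \<bullet> \<xi>)) * q n x) = ((cis (t n * (b \<bullet> \<xi>)) - 1) /\<^sub>R t n) * J" for n
  proof -
    have "(LINT x|lborel. cis (- (x \<bullet> \<xi>)) * g (t n *\<^sub>R b + x)) =
        (LINT x|lborel. cis (t n * (b \<bullet> \<xi>)) * (cis (- ((t n *\<^sub>R b + x) \<bullet> \<xi>)) * g (t n *\<^sub>R b + x)))"
      by (simp add: inner_add_left cis_mult flip: mult.assoc)
    also have "\<dots> = (LINT x|lborel. cis (t n * (b \<bullet> \<xi>)) * (cis (- (x \<bullet> \<xi>)) * g x))"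
      by (rule lborel_integral_translate) measurable
    also have "\<dots> = cis (t n * (b \<bullet> \<xi>)) * J" by (simp add: J_def)
    finally have 1: "(LINT x|lborel. cis (- (x \<bullet> \<xi>)) * g (t n *\<^sub>R b + x)) = cis (t n * (b \<bullet> \<xi>)) * J" .
    have tg: "integrable lborel (\<lambda>x. g (t n *\<^sub>R b + x))"
      using test_function_integrable[OF test_function_affine[OF g, of 1 "t n *\<^sub>R b"]] by (simp add: add.commute)
    have "(LINT x|lborel. cis (- (x \<bullet> \<xi>)) * q n x) = (LINT x|lborel.
        (cis (- (x \<bullet> \<xi>)) * g (t n *\<^sub>R b + x) - cis (- (x \<bullet> \<xi>)) * g x) /\<^sub>R t n)"
      by (simp add: q_def algebra_simps)
    also have "\<dots> = (LINT x|lborel. (cis (- (x \<bullet> \<xi>)) * g (t n *\<^sub>R b + x) - cis (- (x \<bullet> \<xi>)) * g x)) /\<^sub>R t n"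
      by (rule integral_scaleR_right)
    also have "\<dots> = (cis (t n * (b \<bullet> \<xi>)) * J - J) /\<^sub>R t n"
      unfolding 1[symmetric] unfolding J_def
      by (subst Bochner_Integration.integral_diff) (auto intro!: integrable_cis_mult tg gi)
    finally show ?thesis by (simp add: algebra_simps)
  qed
  have "(\<lambda>n. ((cis (t n * (b \<bullet> \<xi>)) - 1) /\<^sub>R t n) * J) \<longlonglongrightarrow> (\<i> * of_real (b \<bullet> \<xi>)) * J"
  proof (intro tendsto_mult tendsto_const)
    have "norm ((cis (t n * (b \<bullet> \<xi>)) - 1) /\<^sub>R t n - \<i> * of_real (b \<bullet> \<xi>)) \<le> t n * (b \<bullet> \<xi>)\<^sup>2" for n
    proof -
      have "(cis (t n * (b \<bullet> \<xi>)) - 1) /\<^sub>R t n - \<i> * of_real (b \<bullet> \<xi>) =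
          (cis (t n * (b \<bullet> \<xi>)) - 1 - \<i> * of_real (t n * (b \<bullet> \<xi>))) /\<^sub>R t n"
        using t(1)[of n] by (simp add: scaleR_conv_of_real field_simps)
      then have "norm ((cis (t n * (b \<bullet> \<xi>)) - 1) /\<^sub>R t n - \<i> * of_real (b \<bullet> \<xi>)) \<le>
          inverse (t n) * (t n * (b \<bullet> \<xi>))\<^sup>2"
        using norm_cis_minus_linear_le[of "t n * (b \<bullet> \<xi>)"] t(1)[of n]
        by (simp add: mult_left_mono)
      then show ?thesis using t(1)[of n] by (simp add: power2_eq_square field_simps)
    qed
    moreover have "(\<lambda>n. t n * (b \<bullet> \<xi>)\<^sup>2) \<longlonglongrightarrow> 0"
      by (rule tendsto_mult_left_zero[OF t0])
    ultimately have "(\<lambda>n. (cis (t n * (b \<bullet> \<xi>)) - 1) /\<^sub>R t n - \<i> * of_real (b \<bullet> \<xi>)) \<longlonglongrightarrow> 0"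
      by (rule Lim_null_comparison[OF always_eventually[OF allI]])
    then show "(\<lambda>n. (cis (t n * (b \<bullet> \<xi>)) - 1) /\<^sub>R t n) \<longlonglongrightarrow> \<i> * of_real (b \<bullet> \<xi>)"
      by (rule LIM_zero_cancel)
  qed
  then have "(LINT x|lborel. cis (- (x \<bullet> \<xi>)) * partial_deriv b g x) = (\<i> * of_real (b \<bullet> \<xi>)) * J"
    using lim unfolding qJ by (blast intro: LIMSEQ_unique)
  then show ?thesis
    unfolding fourier_def J_def by simp
qed

text \<open>One power of \<open>1 + |\<xi>|\<close> is bounded by \<open>1 + \<Sum>|\<xi>\<^sub>b|\<close>, and a factor \<open>\<xi>\<^sub>b\<close> turns the transform of
  \<open>g\<close> into the transform of a partial derivative of \<open>g\<close>, which is a test function as well.\<close>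

lemma fourier_test_decay:
  fixes g :: "'a::euclidean_space \<Rightarrow> complex"
  assumes "test_function g"
  shows "\<exists>B. \<forall>\<xi>. (1 + norm \<xi>) ^ N * norm (fourier g \<xi>) \<le> B"
  using assms
proof (induction N arbitrary: g)
  case 0
  then show ?case
    using norm_fourier_le[OF test_function_integrable] by fastforce
next
  case (Suc N)
  obtain B where B: "\<And>\<xi>. (1 + norm \<xi>) ^ N * norm (fourier g \<xi>) \<le> B"
    using Suc by blast
  have "test_function (partial_deriv b g)" if "b \<in> Basis" for b
    using test_function_mixed_deriv[OF Suc.prems, of "[b]"] that by simp
  then have "\<forall>b\<in>Basis. \<exists>C. \<forall>\<xi>. (1 + norm \<xi>) ^ N * norm (fourier (partial_deriv b g) \<xi>) \<le> C"
    using Suc.IH by blast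
  then obtain C where C: "\<And>b \<xi>. b \<in> Basis \<Longrightarrow> (1 + norm \<xi>) ^ N * norm (fourier (partial_deriv b g) \<xi>) \<le> C b"
    by metis
  have "(1 + norm \<xi>) ^ Suc N * norm (fourier g \<xi>) \<le> B + (\<Sum>b\<in>Basis. C b)" for \<xi>
  proof -
    let ?w = "(1 + norm \<xi>) ^ N" and ?F = "norm (fourier g \<xi>)"
    have "(1 + norm \<xi>) ^ Suc N * ?F = ?w * ?F + norm \<xi> * (?w * ?F)" by (simp add: algebra_simps)
    also have "norm \<xi> * (?w * ?F) \<le> (\<Sum>b\<in>Basis. \<bar>\<xi> \<bullet> b\<bar>) * (?w * ?F)"
      by (intro mult_right_mono norm_le_l1) auto
    also have "\<dots> = (\<Sum>b\<in>Basis. ?w * norm (fourier (partial_deriv b g) \<xi>))"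
      unfolding sum_distrib_right
      by (intro sum.cong refl) (simp add: fourier_partial_deriv[OF Suc.prems] norm_mult inner_commute)
    also have "\<dots> \<le> (\<Sum>b\<in>Basis. C b)"
      by (intro sum_mono C)
    finally show ?thesis using B[of \<xi>] by simp
  qed
  then show ?case by blast
qed

lemma fourier_test_schwartz:
  fixes g :: "'a::euclidean_space \<Rightarrow> complex"
  assumes "test_function g"
  shows "fourier g \<in> schwartz"
  unfolding schwartz_iff
proof (intro conjI allI ballI smooth_fourier[OF assms])
  fix N and bs :: "'a list"
  obtain g' where "test_function g'" "mixed_deriv bs (fourier g) = fourier g'"
    using mixed_deriv_fourier[OF assms] by blast
  then show "\<exists>B. \<forall>x. (1 + norm x) ^ N * norm (mixed_deriv bs (fourier g) x) \<le> B"
    using fourier_test_decay by auto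
qed

section \<open>Fourier inversion for test functions\<close>

lemma
  fixes f :: "'a::euclidean_space \<Rightarrow> real \<Rightarrow> complex"
  assumes f: "\<And>b. b \<in> Basis \<Longrightarrow> integrable lborel (f b)"
  shows integrable_lborel_prod: "integrable lborel (\<lambda>x. \<Prod>b\<in>Basis. f b (x \<bullet> b))"
    and integral_lborel_prod: "(LINT x|lborel. (\<Prod>b\<in>Basis. f b (x \<bullet> b))) = (\<Prod>b\<in>Basis. LINT t|lborel. f b t)"
proof -
  interpret product_sigma_finite "\<lambda>_::'a. lborel :: real measure"
    by standard
  let ?T = "\<lambda>x. \<Sum>b\<in>(Basis :: 'a set). x b *\<^sub>R b"
  have [measurable]: "f b \<in> borel_measurable borel" if "b \<in> Basis" for b
    using f[OF that] by auto
  have T [measurable]: "?T \<in> (\<Pi>\<^sub>M b\<in>(Basis :: 'a set). lborel) \<rightarrow>\<^sub>M borel" by measurable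
  have F [measurable]: "(\<lambda>x. \<Prod>b\<in>Basis. f b (x \<bullet> b)) \<in> borel_measurable borel" by measurable
  have eq: "(\<Prod>b\<in>Basis. f b (?T x \<bullet> b)) = (\<Prod>b\<in>Basis. f b (x b))" for x
    by (intro prod.cong refl) (simp add: inner_sum_left inner_Basis if_distrib cong: if_cong)
  show "integrable lborel (\<lambda>x. \<Prod>b\<in>Basis. f b (x \<bullet> b))"
    unfolding lborel_eq[where 'a='a] by (subst integrable_distr_eq[OF T F], unfold eq)
      (intro product_integrable_prod f finite_Basis)
  show "(LINT x|lborel. (\<Prod>b\<in>Basis. f b (x \<bullet> b))) = (\<Prod>b\<in>Basis. LINT t|lborel. f b t)"
    unfolding lborel_eq[where 'a='a] by (subst integral_distr[OF T F], unfold eq)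
      (intro product_integral_prod f finite_Basis)
qed

lemma
  shows integrable_gaussian_cis_real: "integrable lborel (\<lambda>t. cis (t * w) * complex_of_real (exp (- t\<^sup>2 / 2)))"
    and gaussian_fourier_real:
      "(LINT t|lborel. cis (t * w) * complex_of_real (exp (- t\<^sup>2 / 2))) = of_real (sqrt (2 * pi) * exp (- w\<^sup>2 / 2))"
proof -
  have g: "exp (- t\<^sup>2 / 2) = sqrt (2 * pi) * std_normal_density t" for t
    by (simp add: std_normal_density_def)
  have 1: "cis (t * w) * complex_of_real (exp (- t\<^sup>2 / 2)) = sqrt (2 * pi) *\<^sub>R (std_normal_density t *\<^sub>R iexp (w * t))" for t
    unfolding g by (simp add: cis_conv_exp scaleR_conv_of_real mult_ac)
  have "integrable lborel (\<lambda>t. exp (- t\<^sup>2 / 2) :: real)"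
    unfolding g by (intro integrable_mult_right integrable_normal_density) auto
  then have "integrable lborel (\<lambda>t. complex_of_real (exp (- t\<^sup>2 / 2)))"
    by simp
  then show "integrable lborel (\<lambda>t. cis (t * w) * complex_of_real (exp (- t\<^sup>2 / 2)))"
    by (intro integrable_cis_mult) auto
  have "(LINT t|lborel. std_normal_density t *\<^sub>R iexp (w * t)) = char std_normal_distribution w"
    unfolding char_def by (subst integral_density) auto
  also have "\<dots> = of_real (exp (- w\<^sup>2 / 2))"
    by (simp add: char_std_normal_distribution)
  finally show "(LINT t|lborel. cis (t * w) * complex_of_real (exp (- t\<^sup>2 / 2))) = of_real (sqrt (2 * pi) * exp (- w\<^sup>2 / 2))"
    unfolding 1 by (simp add: scaleR_conv_of_real)
qed

text \<open>Normalised so that the Fourier transform maps it to itself.\<close>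

definition gaussian :: "'a::euclidean_space \<Rightarrow> complex" where
  "gaussian x = of_real (exp (- (norm x)\<^sup>2 / 2))"

lemma gaussian_eq_prod: "gaussian x = (\<Prod>b\<in>Basis. of_real (exp (- (x \<bullet> b)\<^sup>2 / 2)))"
proof -
  have "- (norm x)\<^sup>2 / 2 = (\<Sum>b\<in>Basis. - (x \<bullet> b)\<^sup>2 / 2)"
    unfolding power2_norm_eq_inner
    by (subst euclidean_inner) (simp add: sum_negf sum_divide_distrib power2_eq_square) 
  then show ?thesis
    by (simp add: gaussian_def exp_sum flip: of_real_prod)
qed

lemma cis_sum: "finite A \<Longrightarrow> cis (\<Sum>i\<in>A. f i) = (\<Prod>i\<in>A. cis (f i))"
  by (induction A rule: finite_induct) (simp_all flip: cis_mult)

lemma cis_inner: "cis (x \<bullet> y) = (\<Prod>b\<in>Basis. cis ((x \<bullet> b) * (y \<bullet> b)))"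
  by (simp add: euclidean_inner[of x y] cis_sum)

lemma
  fixes w :: "'a::euclidean_space"
  shows integrable_gaussian_cis: "integrable lborel (\<lambda>x. cis (x \<bullet> w) * gaussian x)"
    and gaussian_fourier:
      "(LINT x|lborel. cis (x \<bullet> w) * gaussian x) = (2 * pi) powr (real DIM('a) / 2) *\<^sub>R gaussian w"
proof -
  have 1: "cis (x \<bullet> w) * gaussian x =
      (\<Prod>b\<in>Basis. cis ((x \<bullet> b) * (w \<bullet> b)) * of_real (exp (- (x \<bullet> b)\<^sup>2 / 2)))" for x
    by (simp add: cis_inner gaussian_eq_prod prod.distrib)
  show "integrable lborel (\<lambda>x. cis (x \<bullet> w) * gaussian x)"
    unfolding 1 by (rule integrable_lborel_prod[OF integrable_gaussian_cis_real])
  have "sqrt (2 * pi) ^ DIM('a) = (2 * pi) powr (real DIM('a) / 2)"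
    by (simp add: powr_half_sqrt[symmetric] powr_powr flip: powr_realpow)
  moreover have "(LINT x|lborel. cis (x \<bullet> w) * gaussian x) =
      (\<Prod>b\<in>Basis. of_real (sqrt (2 * pi) * exp (- (w \<bullet> b)\<^sup>2 / 2)))"
    unfolding 1 integral_lborel_prod[OF integrable_gaussian_cis_real] gaussian_fourier_real ..
  ultimately show "(LINT x|lborel. cis (x \<bullet> w) * gaussian x) = (2 * pi) powr (real DIM('a) / 2) *\<^sub>R gaussian w"
    by (simp add: prod.distrib gaussian_eq_prod scaleR_conv_of_real flip: of_real_power)
qed

lemma lborel_integral_affine:
  fixes h :: "'a::euclidean_space \<Rightarrow> complex"
  assumes [measurable]: "h \<in> borel_measurable borel" and c: "c > 0"
  shows "(LINT x|lborel. h x) = c ^ DIM('a) *\<^sub>R (LINT x|lborel. h (v + c *\<^sub>R x))"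
  using c by (subst lborel_affine[of c v]) (auto simp: integral_density integral_distr)

lemma measurable_gaussian [measurable]: "gaussian \<in> borel_measurable borel"
  unfolding gaussian_def by measurable

text \<open>The classical argument by Gaussian summation. With the factor \<open>gaussian (t x)\<close> inserted, the double integral
  over \<open>x\<close> and the variable of \<open>g\<close> converges absolutely, and after exchanging the integrals the inner one is an
  explicit Gaussian concentrated near \<open>\<xi>\<close>. Then let \<open>t\<close> tend to 0 on both sides.\<close>

lemma fourier_inversion:
  fixes g :: "'a::euclidean_space \<Rightarrow> complex"
  assumes g: "test_function g"
  shows "(LINT x|lborel. cis (x \<bullet> \<xi>) * fourier g x) = (2 * pi) powr (real DIM('a) / 2) *\<^sub>R g \<xi>"
proof -
  let ?C = "(2 * pi) powr (real DIM('a) / 2)"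
  let ?c = "(2 * pi) powr (- real DIM('a) / 2)"
  have Cc: "?c * ?C = 1" by (simp add: powr_add[symmetric])
  have gi: "integrable lborel g" by (rule test_function_integrable[OF g])
  have gc: "continuous_on UNIV g" using g by (auto simp: test_function_iff intro: smooth_continuous')
  have [measurable]: "g \<in> borel_measurable borel" using gi by auto
  obtain B where B: "\<And>x. norm (g x) \<le> B" using test_function_bounded[OF g] by blast
  have Fi: "integrable lborel (fourier g)"
    by (rule schwartz_integrable[OF fourier_test_schwartz[OF g]])
  have [measurable]: "fourier g \<in> borel_measurable borel" using Fi by auto
  have gaussian1: "norm (gaussian x) \<le> 1" for x :: 'a
    by (simp add: gaussian_def)
  have gaussian_int: "integrable lborel (gaussian :: 'a \<Rightarrow> complex)"
    using integrable_gaussian_cis[of "0::'a"] by simp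
  have gaussian_cont: "continuous_on UNIV (gaussian :: 'a \<Rightarrow> complex)"
    unfolding gaussian_def by (intro continuous_intros) auto
  define t where "t n = inverse (real (Suc n))" for n
  have t: "0 < t n" for n by (auto simp: t_def)
  have t0: "t \<longlonglongrightarrow> 0" unfolding t_def by (rule LIMSEQ_inverse_real_of_nat)
  have lim1: "(\<lambda>n. LINT x|lborel. gaussian (t n *\<^sub>R x) * (cis (x \<bullet> \<xi>) * fourier g x)) \<longlonglongrightarrow>
      (LINT x|lborel. cis (x \<bullet> \<xi>) * fourier g x)"
  proof (rule integral_dominated_convergence[where w = "\<lambda>x. norm (fourier g x)"])
    show "AE x in lborel. (\<lambda>n. gaussian (t n *\<^sub>R x) * (cis (x \<bullet> \<xi>) * fourier g x)) \<longlonglongrightarrow> cis (x \<bullet> \<xi>) * fourier g x"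
    proof (rule AE_I2)
      fix x :: 'a
      have "(\<lambda>n. t n *\<^sub>R x) \<longlonglongrightarrow> 0 *\<^sub>R x" by (intro tendsto_intros t0)
      then have "(\<lambda>n. gaussian (t n *\<^sub>R x)) \<longlonglongrightarrow> gaussian (0 *\<^sub>R x)"
        by (intro continuous_on_tendsto_compose[OF gaussian_cont]) auto
      then have "(\<lambda>n. gaussian (t n *\<^sub>R x) * (cis (x \<bullet> \<xi>) * fourier g x)) \<longlonglongrightarrow> gaussian (0 *\<^sub>R x) * (cis (x \<bullet> \<xi>) * fourier g x)"
        by (intro tendsto_intros)
      then show "(\<lambda>n. gaussian (t n *\<^sub>R x) * (cis (x \<bullet> \<xi>) * fourier g x)) \<longlonglongrightarrow> cis (x \<bullet> \<xi>) * fourier g x"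
        by (simp add: gaussian_def)
    qed
    show "AE x in lborel. norm (gaussian (t n *\<^sub>R x) * (cis (x \<bullet> \<xi>) * fourier g x)) \<le> norm (fourier g x)" for n
      using gaussian1 by (auto simp: norm_mult intro!: mult_left_le_one_le)
  qed (use Fi in auto)
  have lim2: "(\<lambda>n. LINT z|lborel. g (\<xi> + t n *\<^sub>R z) * gaussian z) \<longlonglongrightarrow> (LINT z|lborel. g \<xi> * gaussian (z::'a))"
  proof (rule integral_dominated_convergence[where w = "\<lambda>x::'a. B * norm (gaussian x)"])
    show "AE x in lborel. (\<lambda>n. g (\<xi> + t n *\<^sub>R x) * gaussian x) \<longlonglongrightarrow> g \<xi> * gaussian x"
    proof (rule AE_I2)
      fix x :: 'a
      have "(\<lambda>n. \<xi> + t n *\<^sub>R x) \<longlonglongrightarrow> \<xi> + 0 *\<^sub>R x" by (intro tendsto_intros t0)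
      then have "(\<lambda>n. g (\<xi> + t n *\<^sub>R x)) \<longlonglongrightarrow> g (\<xi> + 0 *\<^sub>R x)"
        by (intro continuous_on_tendsto_compose[OF gc]) auto
      then show "(\<lambda>n. g (\<xi> + t n *\<^sub>R x) * gaussian x) \<longlonglongrightarrow> g \<xi> * gaussian x"
        by (auto intro!: tendsto_intros)
    qed
    show "AE x in lborel. norm (g (\<xi> + t n *\<^sub>R x) * gaussian x) \<le> B * norm (gaussian x)" for n
      using B by (auto simp: norm_mult intro!: mult_right_mono)
  qed (use gaussian_int in auto)
  have scaled: "(LINT x|lborel. gaussian (t n *\<^sub>R x) * cis (x \<bullet> w)) = (inverse (t n) ^ DIM('a) * ?C) *\<^sub>R gaussian (inverse (t n) *\<^sub>R w)" for n and w :: 'a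
  proof -
    have "(LINT x|lborel. gaussian (t n *\<^sub>R x) * cis (x \<bullet> w)) =
        inverse (t n) ^ DIM('a) *\<^sub>R (LINT x|lborel. gaussian (t n *\<^sub>R (0 + inverse (t n) *\<^sub>R x)) * cis ((0 + inverse (t n) *\<^sub>R x) \<bullet> w))"
      using t[of n] by (intro lborel_integral_affine) auto
    also have "(LINT x|lborel. gaussian (t n *\<^sub>R (0 + inverse (t n) *\<^sub>R x)) * cis ((0 + inverse (t n) *\<^sub>R x) \<bullet> w)) =
        (LINT x|lborel. cis (x \<bullet> (inverse (t n) *\<^sub>R w)) * gaussian x)"
      using t[of n] by (intro Bochner_Integration.integral_cong refl) (simp add: mult.commute)
    finally show ?thesis unfolding gaussian_fourier scaleR_scaleR .
  qed
  \<comment> \<open>Exchange the integrals, and substitute \<open>y = \<xi> + t z\<close> for the variable \<open>y\<close> of \<open>g\<close>.\<close>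
  have key: "(LINT x|lborel. gaussian (t n *\<^sub>R x) * (cis (x \<bullet> \<xi>) * fourier g x)) =
      (LINT z|lborel. g (\<xi> + t n *\<^sub>R z) * gaussian z)" for n
  proof -
    have int: "integrable lborel (\<lambda>x::'a. gaussian (t n *\<^sub>R x) * cis (x \<bullet> \<xi>))"
    proof -
      have "integrable lborel (\<lambda>x::'a. t n ^ DIM('a) *\<^sub>R gaussian (0 + t n *\<^sub>R x))"
        using t[of n] gaussian_int
        by (subst (asm) lborel_affine[of "t n" 0]) (auto simp: integrable_density integrable_distr_eq)
      from integrable_scaleR_right[OF this, of "inverse (t n ^ DIM('a))"]
      have "integrable lborel (\<lambda>x::'a. gaussian (t n *\<^sub>R x))"
        using t[of n] by simp
      from integrable_cis_mult[of "\<lambda>x. x \<bullet> \<xi>", OF _ this] show ?thesis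
        by (simp add: mult.commute)
    qed
    have "(LINT x|lborel. gaussian (t n *\<^sub>R x) * (cis (x \<bullet> \<xi>) * fourier g x)) =
        ?c *\<^sub>R (LINT x|lborel. (gaussian (t n *\<^sub>R x) * cis (x \<bullet> \<xi>)) * (LINT y|lborel. cis (- (y \<bullet> x)) * g y))"
      unfolding fourier_def by (simp add: mult.assoc)
    also have "(LINT x|lborel. (gaussian (t n *\<^sub>R x) * cis (x \<bullet> \<xi>)) * (LINT y|lborel. cis (- (y \<bullet> x)) * g y)) =
        (LINT y|lborel. (LINT x|lborel. (gaussian (t n *\<^sub>R x) * cis (x \<bullet> \<xi>)) * cis (- (y \<bullet> x))) * g y)"
      by (rule Fubini_bounded_kernel[OF sigma_finite_lborel sigma_finite_lborel int gi]) auto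
    also have "\<dots> = (LINT y|lborel. (LINT x|lborel. gaussian (t n *\<^sub>R x) * cis (x \<bullet> (\<xi> - y))) * g y)"
      by (simp add: mult.assoc cis_mult inner_diff_right inner_commute)
    also have "\<dots> = (LINT y|lborel. (inverse (t n) ^ DIM('a) * ?C) *\<^sub>R (gaussian (inverse (t n) *\<^sub>R (\<xi> - y)) * g y))"
      unfolding scaled by simp
    also have "\<dots> = t n ^ DIM('a) *\<^sub>R (LINT z|lborel. (inverse (t n) ^ DIM('a) * ?C) *\<^sub>R
        (gaussian (inverse (t n) *\<^sub>R (\<xi> - (\<xi> + t n *\<^sub>R z))) * g (\<xi> + t n *\<^sub>R z)))"
      by (rule lborel_integral_affine[OF _ t]) measurable
    also have "\<dots> = ?C *\<^sub>R (LINT z|lborel. g (\<xi> + t n *\<^sub>R z) * gaussian z)"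
    proof -
      have "inverse (t n) *\<^sub>R (\<xi> - (\<xi> + t n *\<^sub>R z)) = - z" for z
        using t[of n] by simp
      then show ?thesis
        using t[of n] by (simp add: gaussian_def mult.commute power_inverse)
    qed
    finally show ?thesis
      using Cc by simp
  qed
  have "(LINT x|lborel. cis (x \<bullet> \<xi>) * fourier g x) = (LINT z|lborel. g \<xi> * gaussian (z::'a))"
    using lim1 lim2 unfolding key by (rule LIMSEQ_unique)
  also have "\<dots> = g \<xi> * ?C *\<^sub>R gaussian (0::'a)"
    using gaussian_fourier[of "0::'a"] by simp
  also have "\<dots> = ?C *\<^sub>R g \<xi>"
    by (simp add: gaussian_def)
  finally show ?thesis .
qed

section \<open>Littlewood--Paley blocks of band-limited functions\<close>

text \<open>Suppose that the difference \<open>h\<close> of the two functions does not vanish at \<open>x\<^sub>0\<close>. Testing with a bump that lives where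
  \<open>h\<close> is close to \<open>h(x\<^sub>0)\<close> gives a contradiction. A dilated and translated copy of the generator
  \<open>\<phi>\<close> serves as the bump.\<close>

lemma continuous_generates_unique:
  fixes g1 g2 :: "'a::euclidean_space \<Rightarrow> complex"
  assumes \<phi>: "dyadic_generator (\<phi> :: 'a \<Rightarrow> real)"
    and g1: "continuous_on UNIV g1" "generates g1 S" and g2: "continuous_on UNIV g2" "generates g2 S"
  shows "g1 = g2"
proof (rule ccontr)
  assume "g1 \<noteq> g2"
  then obtain x0 where x0: "g1 x0 \<noteq> g2 x0" by blast
  define h where "h x = g1 x - g2 x" for x
  have hc: "continuous_on UNIV h" unfolding h_def by (intro continuous_intros g1 g2)
  define d where "d = norm (h x0)"
  have d: "d > 0" using x0 by (simp add: d_def h_def)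
  obtain \<delta> where \<delta>: "\<delta> > 0" "\<And>x. norm (x - x0) < \<delta> \<Longrightarrow> norm (h x - h x0) < d / 2"
    using hc[unfolded continuous_on_iff, rule_format, of x0 "d / 2"] d by (auto simp: dist_norm)
  \<comment> \<open>\<open>\<phi>\<close> vanishes from radius \<open>3/2\<close> on, so its copy vanishes from radius \<open>3\<delta>/4 < \<delta>\<close> on.\<close>
  define c where "c = 2 / \<delta>"
  have c: "c > 0" using \<delta> by (simp add: c_def)
  define \<kappa> where "\<kappa> x = \<phi> (c *\<^sub>R x + (- c) *\<^sub>R x0)" for x
  have t\<kappa>: "test_function \<kappa>"
    unfolding \<kappa>_def using \<phi> c by (intro test_function_affine) (auto simp: dyadic_generator_def)
  have \<kappa>0: "\<kappa> x \<ge> 0" for x using \<phi> by (simp add: \<kappa>_def dyadic_generator_def)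
  have eq: "c *\<^sub>R x + (- c) *\<^sub>R x0 = c *\<^sub>R (x - x0)" for x by (simp add: algebra_simps)
  have norm_eq: "norm (c *\<^sub>R (x - x0)) = c * norm (x - x0)" for x
    using c by (simp only: norm_scaleR abs_of_pos)
  have \<kappa>1: "\<kappa> x = 1" if "norm (x - x0) \<le> 1 / c" for x
  proof -
    have "norm (c *\<^sub>R (x - x0)) \<le> 1" unfolding norm_eq using that c by (simp add: field_simps)
    then show ?thesis using \<phi> unfolding \<kappa>_def eq dyadic_generator_def by blast
  qed
  have \<kappa>2: "\<kappa> x = 0" if "norm (x - x0) \<ge> \<delta>" for x
  proof -
    have "norm (c *\<^sub>R (x - x0)) \<ge> 3 / 2" unfolding norm_eq using that c \<delta>(1) by (simp add: c_def field_simps)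
    then show ?thesis using \<phi> unfolding \<kappa>_def eq dyadic_generator_def by blast
  qed
  have tc: "test_function (\<lambda>x. complex_of_real (\<kappa> x))"
    by (rule test_function_bounded_linear[OF bounded_linear_of_real t\<kappa>])
  have sc: "(\<lambda>x. complex_of_real (\<kappa> x)) \<in> schwartz" by (rule test_function_schwartz[OF tc])
  have \<kappa>i: "integrable lborel \<kappa>"
    using test_function_integrable[OF tc] by (simp add: complex_of_real_integrable_eq)
  have \<kappa>c: "continuous_on UNIV \<kappa>" using t\<kappa> by (auto simp: test_function_iff intro: smooth_continuous')
  have int: "integrable lborel (\<lambda>x. f x * complex_of_real (\<kappa> x))" if f: "continuous_on UNIV f" for f
  proof -
    have "integrable lborel (\<lambda>x. indicator (cball x0 \<delta>) x *\<^sub>R (f x * complex_of_real (\<kappa> x)))"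
      by (intro borel_integrable_compact continuous_intros continuous_on_subset[OF f] continuous_on_subset[OF \<kappa>c]) auto
    also have "(\<lambda>x. indicator (cball x0 \<delta>) x *\<^sub>R (f x * complex_of_real (\<kappa> x))) = (\<lambda>x. f x * complex_of_real (\<kappa> x))"
      using \<kappa>2 by (auto simp: fun_eq_iff indicator_def dist_norm norm_minus_commute)
    finally show ?thesis .
  qed
  have "(LINT x|lborel. g1 x * complex_of_real (\<kappa> x)) = (LINT x|lborel. g2 x * complex_of_real (\<kappa> x))"
    using g1 g2 tc by (simp add: generates_regular)
  then have "(LINT x|lborel. h x * complex_of_real (\<kappa> x)) = 0"
    unfolding h_def left_diff_distrib by (subst Bochner_Integration.integral_diff) (auto intro: int g1 g2)
  then have "(LINT x|lborel. (h x - h x0) * complex_of_real (\<kappa> x)) = - h x0 * of_real (LINT x|lborel. \<kappa> x)"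
    unfolding left_diff_distrib
    by (subst Bochner_Integration.integral_diff) (use \<kappa>i in \<open>auto intro: int hc\<close>)
  then have "d * \<bar>(LINT x|lborel. \<kappa> x)\<bar> = norm (LINT x|lborel. (h x - h x0) * complex_of_real (\<kappa> x))"
    by (simp add: norm_mult d_def)
  also have "\<dots> \<le> (LINT x|lborel. d / 2 * \<kappa> x)"
  proof (rule Bochner_Integration.integral_norm_bound_integral)
    show "integrable lborel (\<lambda>x. (h x - h x0) * complex_of_real (\<kappa> x))"
      by (intro int continuous_intros hc)
    show "integrable lborel (\<lambda>x. d / 2 * \<kappa> x)" using \<kappa>i by simp
    fix x
    show "norm ((h x - h x0) * complex_of_real (\<kappa> x)) \<le> d / 2 * \<kappa> x"
    proof (cases "norm (x - x0) < \<delta>")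
      case True
      then show ?thesis
        using \<kappa>0[of x] mult_right_mono[OF less_imp_le[OF \<delta>(2)[OF True]], of "\<kappa> x"]
        by (simp add: norm_mult)
    qed (use \<kappa>2[of x] in auto)
  qed
  finally have le: "d * (LINT x|lborel. \<kappa> x) \<le> d / 2 * (LINT x|lborel. \<kappa> x)"
    by (simp add: abs_of_nonneg \<kappa>0 integral_nonneg_AE)
  have "0 < measure lborel (cball x0 (1 / c))"
    using c by (simp add: content_cball_pos)
  also have "\<dots> = (LINT x|lborel. indicator (cball x0 (1 / c)) x)"
    by simp
  also have "\<dots> \<le> (LINT x|lborel. \<kappa> x)"
  proof (intro integral_mono \<kappa>i)
    show "integrable lborel (indicator (cball x0 (1 / c)) :: 'a \<Rightarrow> real)"
      using emeasure_bounded_finite[of "cball x0 (1 / c)"] by (intro integrable_real_indicator) auto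
    show "indicator (cball x0 (1 / c)) x \<le> \<kappa> x" for x
      using \<kappa>0 \<kappa>1 by (auto simp: indicator_def dist_norm norm_minus_commute)
  qed
  finally show False using le d by simp
qed

lemma fun_of_dist_eq:
  fixes g :: "'a::euclidean_space \<Rightarrow> complex"
  assumes "dyadic_generator (\<phi> :: 'a \<Rightarrow> real)" "continuous_on UNIV g" "generates g S"
  shows "fun_of_dist S = g"
  unfolding fun_of_dist_def
  using assms continuous_generates_unique[OF assms(1)] by (intro the_equality) blast+

lemma test_function_dyadic:
  assumes "dyadic_generator \<phi>"
  shows "test_function (dyadic \<phi> k)"
proof (cases "k = 0")
  case True
  then have "dyadic \<phi> k = \<phi>" by (simp add: dyadic_def fun_eq_iff)
  then show ?thesis using assms by (simp add: dyadic_generator_def)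
next
  case False
  have t: "test_function \<phi>" using assms by (simp add: dyadic_generator_def)
  have "test_function (\<lambda>x. \<phi> (2 powr (- real k) *\<^sub>R x + 0))" "test_function (\<lambda>x. \<phi> (2 powr (- real k + 1) *\<^sub>R x + 0))"
    by (intro test_function_affine t; simp)+
  then obtain R R' where R: "smooth (\<lambda>x. \<phi> (2 powr (- real k) *\<^sub>R x))" "\<forall>x. R < norm x \<longrightarrow> \<phi> (2 powr (- real k) *\<^sub>R x) = 0"
    "smooth (\<lambda>x. \<phi> (2 powr (- real k + 1) *\<^sub>R x))" "\<forall>x. R' < norm x \<longrightarrow> \<phi> (2 powr (- real k + 1) *\<^sub>R x) = 0"
    by (auto simp: test_function_iff)
  then have "\<exists>R. \<forall>x. R < norm x \<longrightarrow> dyadic \<phi> k x = 0"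
    using False by (intro exI[of _ "max R R'"]) (auto simp: dyadic_def)
  moreover have "smooth (dyadic \<phi> k)"
    using smooth_diff[OF R(1,3)] False by (simp add: dyadic_def[abs_def])
  ultimately show ?thesis by (auto simp: test_function_iff)
qed

text \<open>For \<open>k \<ge> 1\<close> both dilations in the difference map the unit ball into itself, where \<open>\<phi>\<close> is 1.\<close>

lemma dyadic_on_unit_ball:
  assumes "dyadic_generator \<phi>" "norm \<xi> \<le> 1"
  shows "dyadic \<phi> k \<xi> = (if k = 0 then 1 else 0)"
proof -
  have 1: "\<phi> (c *\<^sub>R \<xi>) = 1" if "0 \<le> c" "c \<le> 1" for c
  proof -
    have "norm (c *\<^sub>R \<xi>) \<le> 1" using that assms(2) by (simp add: mult_le_one)
    then show ?thesis using assms(1) by (simp add: dyadic_generator_def)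
  qed
  have "2 powr (- real k) \<le> 1" "2 powr (- real k + 1) \<le> 1" if "k \<noteq> 0"
    using that powr_mono[of "- real k" 0 2] powr_mono[of "- real k + 1" 0 2] by auto
  then show ?thesis using 1[of 1] by (auto simp: dyadic_def 1)
qed

text \<open>Integrals of this form are Fourier transforms of finite measures: of the image of \<open>M\<close> under \<open>X\<close>.\<close>

lemma continuous_fourier_integral:
  fixes X :: "'b \<Rightarrow> 'a::euclidean_space"
  assumes "finite_measure M" and [measurable]: "X \<in> borel_measurable M"
  shows "continuous_on UNIV (\<lambda>x. LINT \<omega>|M. cis (x \<bullet> X \<omega>))"
proof -
  interpret finite_measure M by fact
  show ?thesis
    unfolding continuous_on_sequentially o_def
    by (auto intro!: integral_dominated_convergence[where w = "\<lambda>_. 1"] tendsto_intros AE_I2 continuous_on_tendsto_compose[where f = cis and s = UNIV] continuous_intros)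
qed

text \<open>Let \<open>f\<close> be the Fourier transform of a finite measure that lives on the unit ball (the image of \<open>M\<close> under \<open>X\<close>).
  On the unit ball \<open>\<phi>\<^sub>0\<close> is 1 and the other \<open>\<phi>\<^sub>k\<close> vanish. Hence the block with index 0 reproduces \<open>f\<close> and all
  others are zero. To verify this, move the Fourier transforms to the test function: by Fourier inversion, the integral
  of \<open>f\<close> against the transform of \<open>\<phi>\<^sub>k F\<inverse>\<eta>\<close> is the integral of \<open>\<phi>\<^sub>k F\<inverse>\<eta>\<close> with respect to the measure, up to a
  constant factor.\<close>

lemma
  fixes \<phi> :: "'a::euclidean_space \<Rightarrow> real" and X :: "'b \<Rightarrow> 'a" and f :: "'a \<Rightarrow> complex"
  assumes \<phi>: "dyadic_generator \<phi>" and M: "finite_measure M"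
    and X [measurable]: "X \<in> borel_measurable M" and X1: "\<And>\<omega>. \<omega> \<in> space M \<Longrightarrow> norm (X \<omega>) \<le> 1"
    and f: "\<And>x. f x = (LINT \<omega>|M. cis (x \<bullet> X \<omega>))"
  shows band_limited_tempered: "tempered_fun f"
    and lp_block_band_limited: "lp_block \<phi> k f = (if k = 0 then f else (\<lambda>_. 0))"
proof -
  interpret M: finite_measure M by fact
  have sfM: "sigma_finite_measure M" ..
  have cis_int: "integrable M (\<lambda>\<omega>. cis (x \<bullet> X \<omega>))" for x
    by (rule M.integrable_const_bound[where B = 1]) auto
  have fB: "norm (f x) \<le> measure M (space M)" for x
  proof -
    have "norm (f x) \<le> (LINT \<omega>|M. norm (cis (x \<bullet> X \<omega>)))" unfolding f by (rule integral_norm_bound)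
    then show ?thesis by simp
  qed
  have fc: "continuous_on UNIV f"
    unfolding f by (rule continuous_fourier_integral[OF M X])
  have fm [measurable]: "f \<in> borel_measurable borel" using fc by (rule borel_measurable_continuous_onI)
  have reg: "tempered (\<lambda>g. LINT x|lborel. f x * g x)" "generates f (\<lambda>g. LINT x|lborel. f x * g x)"
    using tempered_regular[OF fm fB] fc by (auto simp: generates_regular)
  then show "tempered_fun f" unfolding tempered_fun_def by blast
  define T where "T = dist_of f"
  have T: "tempered T" "generates f T"
    using someI[of "\<lambda>T. tempered T \<and> generates f T"] reg unfolding T_def dist_of_def by blast+
  have swap: "(LINT x|lborel. f x * g x) = (LINT \<omega>|M. LINT x|lborel. cis (x \<bullet> X \<omega>) * g x)"
    if g: "integrable lborel g" for g
  proof -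
    have "(LINT x|lborel. f x * g x) = (LINT x|lborel. g x * (LINT \<omega>|M. cis (x \<bullet> X \<omega>) * 1))"
      by (simp add: f mult.commute)
    also have "\<dots> = (LINT \<omega>|M. (LINT x|lborel. g x * cis (x \<bullet> X \<omega>)) * 1)"
      by (rule Fubini_bounded_kernel[OF sigma_finite_lborel sfM g]) auto
    finally show ?thesis by (simp add: mult.commute)
  qed
  define S where "S = dist_inv_fourier (dist_mult (dyadic \<phi> k) (dist_fourier T))"
  have "S \<eta> = (LINT x|lborel. (if k = 0 then f else (\<lambda>_. 0)) x * \<eta> x)" if \<eta>: "test_function \<eta>" for \<eta>
  proof -
    let ?g = "\<lambda>x. complex_of_real (dyadic \<phi> k x) * inv_fourier \<eta> x"
    have inv: "inv_fourier \<eta> = (\<lambda>x. fourier \<eta> ((-1) *\<^sub>R x + 0))"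
      by (simp add: fun_eq_iff inv_fourier_def fourier_def inner_commute)
    have sd: "smooth (dyadic \<phi> k)" using test_function_dyadic[OF \<phi>] by (simp add: test_function_iff)
    have "smooth (inv_fourier \<eta>)"
      unfolding inv by (intro smooth_affine smooth_fourier \<eta>)
    from test_function_scaleR[OF sd this disjI1[OF test_function_dyadic[OF \<phi>]]]
    have tg: "test_function ?g" by (simp add: scaleR_conv_of_real)
    have "S \<eta> = T (fourier ?g)"
      by (simp add: S_def dist_inv_fourier_def dist_mult_def dist_fourier_def)
    also have "\<dots> = (LINT x|lborel. f x * fourier ?g x)"
      by (rule tempered_generates_schwartz[OF \<phi> T fc fB fourier_test_schwartz[OF tg]])
    also have "\<dots> = (LINT \<omega>|M. LINT x|lborel. cis (x \<bullet> X \<omega>) * fourier ?g x)"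
      by (rule swap[OF schwartz_integrable[OF fourier_test_schwartz[OF tg]]])
    \<comment> \<open>The band limitation enters in the next two steps: \<open>\<phi>\<^sub>k\<close> is evaluated at the points \<open>X \<omega>\<close> only.\<close>
    also have "\<dots> = (LINT \<omega>|M. (2 * pi) powr (real DIM('a) / 2) *\<^sub>R ?g (X \<omega>))"
      unfolding fourier_inversion[OF tg] ..
    also have "\<dots> = (LINT \<omega>|M. (if k = 0 then (LINT x|lborel. cis (x \<bullet> X \<omega>) * \<eta> x) else 0))"
    proof (rule Bochner_Integration.integral_cong[OF refl])
      fix \<omega> assume "\<omega> \<in> space M"
      then have "dyadic \<phi> k (X \<omega>) = (if k = 0 then 1 else 0)"
        by (intro dyadic_on_unit_ball[OF \<phi>] X1)
      moreover have "(2 * pi) powr (real DIM('a) / 2) * (2 * pi) powr (- real DIM('a) / 2) = 1"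
        by (simp add: powr_add[symmetric])
      ultimately show "(2 * pi) powr (real DIM('a) / 2) *\<^sub>R ?g (X \<omega>) =
          (if k = 0 then (LINT x|lborel. cis (x \<bullet> X \<omega>) * \<eta> x) else 0)"
        by (simp add: inv_fourier_def inner_commute)
    qed
    also have "\<dots> = (LINT x|lborel. (if k = 0 then f else (\<lambda>_. 0)) x * \<eta> x)"
      using swap[OF test_function_integrable[OF \<eta>]] by simp
    finally show ?thesis .
  qed
  moreover have "continuous_on UNIV (if k = 0 then f else (\<lambda>_. 0))"
    using fc by simp
  ultimately have "fun_of_dist S = (if k = 0 then f else (\<lambda>_. 0))"
    by (intro fun_of_dist_eq[OF \<phi>]) (auto simp: generates_regular)
  then show "lp_block \<phi> k f = (if k = 0 then f else (\<lambda>_. 0))"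
    by (simp add: lp_block_def S_def T_def)
qed

section \<open>Morrey norms of band-limited functions\<close>

lemma ennpowr_ennreal: "0 \<le> x \<Longrightarrow> ennpowr (ennreal x) a = ennreal (x powr a)"
  by (simp add: ennpowr_def)

lemma ennpowr_le:
  assumes "x \<le> ennreal z" "0 \<le> z" "0 \<le> a"
  shows "ennpowr x a \<le> ennreal (z powr a)"
proof -
  have "x \<noteq> top" using assms(1) by (auto simp: top_unique)
  then obtain y where "x = ennreal y" "0 \<le> y" by (cases x) auto
  then show ?thesis using assms by (simp add: ennpowr_ennreal powr_mono2)
qed

text \<open>Only the block with index 0 survives, and its weight is \<open>2\<^sup>0 = 1\<close>; so the sum (or supremum) over the blocks is the
  function itself.\<close>

lemma tlm_norm_band_limited:
  fixes \<phi> :: "'a::euclidean_space \<Rightarrow> real" and X :: "'b \<Rightarrow> 'a" and F :: "'a \<Rightarrow> real"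
  assumes \<phi>: "dyadic_generator \<phi>" and M: "finite_measure M"
    and X: "X \<in> borel_measurable M" and X1: "\<And>\<omega>. \<omega> \<in> space M \<Longrightarrow> norm (X \<omega>) \<le> 1"
    and F: "\<And>x. complex_of_real (F x) = (LINT \<omega>|M. cis (x \<bullet> X \<omega>))" "\<And>x. 0 \<le> F x"
    and q: "1 \<le> q"
  shows "tlm_norm \<phi> s u p q F = morrey_norm lborel u p (\<lambda>x. ennreal (F x))"
proof -
  let ?a = "\<lambda>k x. norm (lp_block \<phi> k (\<lambda>x. complex_of_real (F x)) x)"
  have a: "?a k x = (if k = 0 then F x else 0)" for k x
    using F(2) by (simp add: lp_block_band_limited[OF \<phi> M X X1 F(1)])
  have 1: "(SUP k. ennreal (2 powr (real k * s) * ?a k x)) = ennreal (F x)" for x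
  proof (rule antisym)
    show "(SUP k. ennreal (2 powr (real k * s) * ?a k x)) \<le> ennreal (F x)"
      by (rule SUP_least) (simp add: a)
    show "ennreal (F x) \<le> (SUP k. ennreal (2 powr (real k * s) * ?a k x))"
      by (rule SUP_upper2[of 0]) (simp_all add: a)
  qed
  have 2: "ennpowr (\<Sum>k. ennreal (2 powr (real k * s * enn2real q) * ?a k x powr enn2real q)) (1 / enn2real q)
      = ennreal (F x)" if "q \<noteq> top" for x
  proof -
    have r: "enn2real q \<ge> 1"
      using that q by (cases q) auto
    have "(\<Sum>k. ennreal (2 powr (real k * s * enn2real q) * ?a k x powr enn2real q)) =
        (\<Sum>k. if k = 0 then ennreal (F x powr enn2real q) else 0)"
      by (intro suminf_cong) (simp add: a)
    also have "\<dots> = ennreal (F x powr enn2real q)"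
      using sums_single[of 0 "\<lambda>_. ennreal (F x powr enn2real q)"] by (simp add: sums_iff)
    finally show ?thesis
      using r F(2)[of x] by (simp add: ennpowr_ennreal powr_powr)
  qed
  have t: "tempered_fun (\<lambda>x. complex_of_real (F x))"
    by (rule band_limited_tempered[OF \<phi> M X X1 F(1)])
  show ?thesis
  proof (cases "q = top")
    case True
    show ?thesis
      unfolding tlm_norm_def Let_def if_P[OF t] if_P[OF True] 1 ..
  next
    case False
    show ?thesis
      unfolding tlm_norm_def Let_def if_P[OF t] if_not_P[OF False] 2[OF False] ..
  qed
qed

text \<open>On the line, the Morrey quotient of a constant over a ball of radius \<open>r\<close> is \<open>c (2r)\<^sup>1\<^sup>/\<^sup>u\<close>, and \<open>u\<close> is finite.\<close>

lemma morrey_norm_const_eq_top: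
  assumes c: "0 < c" and p: "1 \<le> p" and u: "0 < u"
  shows "morrey_norm (lborel :: real measure) u p (\<lambda>_. ennreal c) = top"
  unfolding morrey_norm_def SUP_eq_top_iff
proof (intro allI impI)
  fix z :: ennreal assume "z < top"
  then obtain y where y: "z = ennreal y" "0 \<le> y" by (cases z) auto
  \<comment> \<open>With this radius the Morrey quotient \<open>c (2r)\<^sup>1\<^sup>/\<^sup>u\<close> is \<open>y + 1\<close>.\<close>
  define r where "r = ((y + 1) / c) powr u / 2"
  have r: "0 < r" using y c by (simp add: r_def)
  have "(2 * r) powr (1 / u) = (y + 1) / c"
    using y c u by (simp add: r_def powr_powr)
  then have y1: "y + 1 = c * (2 * r) powr (1 / u)"
    using c by (simp add: field_simps)
  have "emeasure lborel (ball (0::real) r) = ennreal (2 * r)"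
    using r by (simp add: ball_eq_greaterThanLessThan)
  then have i: "(\<integral>\<^sup>+ x\<in>ball 0 r \<inter> space (lborel :: real measure). ennpowr (ennreal c) p \<partial>lborel) = ennreal (c powr p * (2 * r))"
    using c r by (simp add: nn_integral_cmult_indicator ennpowr_ennreal ennreal_mult)
  have m: "measure lborel (ball (0::real) r \<inter> space lborel) = 2 * r"
    using r by (simp add: ball_eq_greaterThanLessThan)
  have "(2 * r) powr (1 / u - 1 / p) * (c powr p * (2 * r)) powr (1 / p) = c * ((2 * r) powr (1 / u - 1 / p) * (2 * r) powr (1 / p))"
    using c r p by (simp add: powr_mult powr_powr)
  also have "\<dots> = y + 1"
    unfolding y1 by (simp add: powr_add[symmetric])
  finally have e: "ennreal (measure lborel (ball (0::real) r \<inter> space lborel) powr (1 / u - 1 / p)) *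
      ennpowr (\<integral>\<^sup>+ x\<in>ball 0 r \<inter> space (lborel :: real measure). ennpowr (ennreal c) p \<partial>lborel) (1 / p) = ennreal (y + 1)"
    unfolding i m using c r by (simp add: ennpowr_ennreal flip: ennreal_mult)
  show "\<exists>i\<in>space (lborel :: real measure) \<times> {0<..}. z < (case i of (y, r) \<Rightarrow>
      ennreal (measure lborel (ball y r \<inter> space lborel) powr (1 / u - 1 / p)) *
      ennpowr (\<integral>\<^sup>+ x\<in>ball y r \<inter> space (lborel :: real measure). ennpowr (ennreal c) p \<partial>lborel) (1 / p))"
  proof (rule bexI[of _ "(0, r)"])
    show "z < (case (0, r) of (y, r) \<Rightarrow>
      ennreal (measure lborel (ball y r \<inter> space lborel) powr (1 / u - 1 / p)) *
      ennpowr (\<integral>\<^sup>+ x\<in>ball y r \<inter> space (lborel :: real measure). ennpowr (ennreal c) p \<partial>lborel) (1 / p))"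
      unfolding prod.case e using y by (simp add: ennreal_less_iff)
  qed (use r in simp)
qed

text \<open>A constant \<open>c > 0\<close> is band-limited: it is the Fourier transform of the point mass \<open>c\<close> at the origin. Here the point
  mass is represented as the image of an interval of length \<open>c\<close> under the zero map.\<close>

lemma tlm_norm_const_eq_top:
  assumes \<psi>: "dyadic_generator (\<psi> :: real \<Rightarrow> real)" and c: "0 < c" and p: "1 \<le> p" and u: "0 < u" and q: "1 \<le> q"
  shows "tlm_norm \<psi> s u p q (\<lambda>_. c) = top"
proof -
  define M where "M = restrict_space lborel {0..c}"
  have M: "emeasure M (space M) = ennreal c"
    using c by (simp add: M_def emeasure_restrict_space space_restrict_space)
  have "tlm_norm \<psi> s u p q (\<lambda>_. c) = morrey_norm (lborel :: real measure) u p (\<lambda>_. ennreal c)"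
  proof (rule tlm_norm_band_limited[OF \<psi>, where X = "\<lambda>_. 0" and M = M and F = "\<lambda>_. c"])
    show "finite_measure M" by (rule finite_measureI) (simp add: M)
    show "complex_of_real c = (LINT \<omega>|M. cis (x \<bullet> 0))" for x :: real
      using c by (simp add: M measure_def scaleR_conv_of_real)
  qed (use c q in auto)
  then show ?thesis unfolding morrey_norm_const_eq_top[OF c p u] .
qed

text \<open>Morrey quotients contain a power of the measure of a ball, and \<open>0 powr a = 0\<close>; so an infinite Morrey norm
  can be inferred from a ball only if its measure is neither zero nor infinite. Both follow by comparison with the
  \<open>d\<close>-dimensional Lebesgue measure of the cylinder of height \<open>2 r\<close> over the ball.\<close>

lemma hyperplane_ball_measure:
  fixes b :: "'a::euclidean_space"
  assumes b: "b \<in> Basis" and r: "0 < r"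
  shows "0 < emeasure (hyperplane_lborel b) (ball 0 r \<inter> {y. y \<bullet> b = 0})"
    and "emeasure (hyperplane_lborel b) (ball 0 r \<inter> {y. y \<bullet> b = 0}) < top"
proof -
  let ?H = "{y::'a. y \<bullet> b = 0}" and ?B = "ball (0::'a) r"
  have sets: "?B \<inter> ?H \<in> sets (hyperplane_lborel b)"
    unfolding hyperplane_lborel_def sets_distr sets_restrict_space by (subst Int_commute) (rule imageI, simp)
  have space: "space (hyperplane_lborel b) = ?H" by (rule space_hyperplane_lborel)
  have nb: "norm b = 1" using b by simp
  let ?C = "{x::'a. norm (x - (x \<bullet> b) *\<^sub>R b) < r \<and> \<bar>x \<bullet> b\<bar> < r}"
  have C [measurable]: "?C \<in> sets borel"
    by measurable
  have inner: "(\<integral>\<^sup>+ t. indicator ?C (y + t *\<^sub>R b) \<partial>lborel) = ennreal (2 * r) * indicator (?B \<inter> ?H) y"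
    if "y \<in> space (hyperplane_lborel b)" for y
  proof -
    have y: "y \<bullet> b = 0" using that by (simp add: space)
    have "b \<bullet> b = 1" using nb by (simp add: norm_eq_1)
    then have "(\<lambda>t. indicator ?C (y + t *\<^sub>R b) :: ennreal) = (\<lambda>t. indicator (?B \<inter> ?H) y * indicator {-r<..<r} t)"
      using y by (auto simp: indicator_def inner_add_left fun_eq_iff)
    then have "(\<integral>\<^sup>+ t. indicator ?C (y + t *\<^sub>R b) \<partial>lborel) = indicator (?B \<inter> ?H) y * emeasure lborel {-r<..<r}"
      by (simp only:) (rule nn_integral_cmult_indicator, simp)
    then show ?thesis
      using r by (simp add: mult.commute)
  qed
  have "emeasure lborel ?C = (\<integral>\<^sup>+ y. (\<integral>\<^sup>+ t. indicator ?C (y + t *\<^sub>R b) \<partial>lborel) \<partial>hyperplane_lborel b)"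
    by (subst nn_integral_lborel_hyperplane[OF b, symmetric]) (use C in simp_all)
  also have "\<dots> = (\<integral>\<^sup>+ y. ennreal (2 * r) * indicator (?B \<inter> ?H) y \<partial>hyperplane_lborel b)"
    by (rule nn_integral_cong[OF inner])
  also have "\<dots> = ennreal (2 * r) * emeasure (hyperplane_lborel b) (?B \<inter> ?H)"
    by (rule nn_integral_cmult_indicator[OF sets])
  finally have eq: "emeasure lborel ?C = ennreal (2 * r) * emeasure (hyperplane_lborel b) (?B \<inter> ?H)" .
  have "bounded ?C"
  proof (rule boundedI[where B = "2 * r"])
    fix x assume x: "x \<in> ?C"
    have "norm x \<le> norm (x - (x \<bullet> b) *\<^sub>R b) + norm ((x \<bullet> b) *\<^sub>R b)"
      using norm_triangle_ineq[of "x - (x \<bullet> b) *\<^sub>R b" "(x \<bullet> b) *\<^sub>R b"] by simp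
    then show "norm x \<le> 2 * r" using x nb by simp
  qed
  then have "emeasure lborel ?C < top" using emeasure_bounded_finite by auto
  then show "emeasure (hyperplane_lborel b) (?B \<inter> ?H) < top"
    unfolding eq using r by (auto simp: ennreal_mult_less_top)
  have "open ?C" by (rule open_Collect_conj; rule open_Collect_less) (intro continuous_intros)+
  moreover have "0 \<in> ?C" using r by simp
  ultimately obtain e where e: "e > 0" "ball 0 e \<subseteq> ?C" by (meson openE)
  have "0 < emeasure lborel (ball (0::'a) e)" using e by (simp add: emeasure_ball)
  also have "\<dots> \<le> emeasure lborel ?C" by (intro emeasure_mono e) simp
  finally show "0 < emeasure (hyperplane_lborel b) (?B \<inter> ?H)"
    unfolding eq by (auto simp: zero_less_iff_neq_zero)
qed

lemma morrey_norm_hyperplane_eq_top: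
  fixes b :: "'a::euclidean_space" and g :: "'a \<Rightarrow> ennreal"
  assumes b: "b \<in> Basis" and r: "0 < r" and g: "\<And>y. norm y < r \<Longrightarrow> y \<bullet> b = 0 \<Longrightarrow> g y = top"
  shows "morrey_norm (hyperplane_lborel b) u p g = top"
proof -
  let ?H = "{y::'a. y \<bullet> b = 0}" and ?B = "ball (0::'a) r"
  let ?E = "emeasure (hyperplane_lborel b) (?B \<inter> ?H)"
  note E = hyperplane_ball_measure[OF b r]
  have sets: "?B \<inter> ?H \<in> sets (hyperplane_lborel b)"
    using E(1) emeasure_notin_sets[of "?B \<inter> ?H" "hyperplane_lborel b"] by (metis less_irrefl)
  have "(\<integral>\<^sup>+ x\<in>?B \<inter> ?H. ennpowr (g x) p \<partial>hyperplane_lborel b) = (\<integral>\<^sup>+ x. top * indicator (?B \<inter> ?H) x \<partial>hyperplane_lborel b)"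
    by (intro nn_integral_cong) (auto simp: indicator_def g ennpowr_def)
  also have "\<dots> = top * ?E" by (rule nn_integral_cmult_indicator[OF sets])
  also have "\<dots> = top" using E(1) by (simp add: ennreal_top_mult)
  finally have i: "(\<integral>\<^sup>+ x\<in>?B \<inter> ?H. ennpowr (g x) p \<partial>hyperplane_lborel b) = top" .
  have "0 < measure (hyperplane_lborel b) (?B \<inter> ?H)"
    using E by (simp add: measure_def enn2real_positive_iff)
  then have "ennreal (measure (hyperplane_lborel b) (?B \<inter> ?H) powr (1 / u - 1 / p)) * ennpowr top (1 / p) = top"
    by (simp add: ennpowr_def ennreal_mult_top)
  moreover have "ennreal (measure (hyperplane_lborel b) (?B \<inter> ?H) powr (1 / u - 1 / p)) *
      ennpowr (\<integral>\<^sup>+ x\<in>?B \<inter> ?H. ennpowr (g x) p \<partial>hyperplane_lborel b) (1 / p) \<le> morrey_norm (hyperplane_lborel b) u p g"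
    unfolding morrey_norm_def space_hyperplane_lborel
    by (rule SUP_upper2[of "(0, r)"]) (use r in auto)
  ultimately show ?thesis by (simp add: i top_unique)
qed

section \<open>A band-limited function that is constant in one direction\<close>

abbreviation uniform01 :: "real measure" where
  "uniform01 \<equiv> restrict_space lborel {0..1}"

text \<open>The characteristic function of the uniform distribution on the unit interval.\<close>

definition wave :: "real \<Rightarrow> complex" where
  "wave t = (LINT \<tau>|uniform01. cis (t * \<tau>))"

text \<open>This is \<open>sin(t/2)\<^sup>2 / (t/2)\<^sup>2\<close> with value 1 at 0 (the Fejer kernel of the real line). It is nonnegative, integrable and band-limited.\<close>

definition fejer :: "real \<Rightarrow> real" where
  "fejer t = (norm (wave t))\<^sup>2"

lemma prob_space_uniform01: "prob_space uniform01"
  by (rule prob_space_restrict_space) auto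

lemma integrable_uniform01_cis: "integrable uniform01 (\<lambda>\<tau>. cis (t * \<tau>))"
proof -
  interpret prob_space uniform01 by (rule prob_space_uniform01)
  show ?thesis
    by (rule integrable_const_bound[where B = 1]) (auto intro!: measurable_restrict_space1)
qed

lemma wave_uminus: "wave (- t) = cnj (wave t)"
proof -
  have "wave (- t) = (LINT \<tau>|uniform01. cnj (cis (t * \<tau>)))"
    by (simp add: wave_def cis_cnj)
  also have "\<dots> = cnj (wave t)"
    unfolding wave_def by (rule Bochner_Integration.integral_cnj)
  finally show ?thesis .
qed

lemma wave_0: "wave 0 = 1"
proof -
  interpret prob_space uniform01 by (rule prob_space_uniform01)
  show ?thesis unfolding wave_def using prob_space by simp
qed

lemma norm_wave_le: "norm (wave t) \<le> 1"
proof -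
  interpret prob_space uniform01 by (rule prob_space_uniform01)
  have "norm (wave t) \<le> (LINT \<tau>|uniform01. norm (cis (t * \<tau>)))"
    unfolding wave_def by (rule integral_norm_bound)
  then show ?thesis using prob_space by simp
qed

lemma wave_identity: "\<i> * of_real t * wave t = cis t - 1"
proof -
  have "(LINT \<tau>|lborel. indicator {0..1} \<tau> *\<^sub>R (\<i> * of_real t * cis (t * \<tau>))) = cis (t * 1) - cis (t * 0)"
  proof (rule integral_FTC_Icc)
    show "((\<lambda>\<tau>. cis (t * \<tau>)) has_vector_derivative \<i> * of_real t * cis (t * \<tau>)) (at \<tau> within {0..1})" for \<tau>
    proof -
      have "((\<lambda>z. exp (\<i> * of_real t * z)) has_field_derivative \<i> * of_real t * exp (\<i> * of_real t * of_real \<tau>)) (at (of_real \<tau>))"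
        by (auto intro!: derivative_eq_intros)
      from has_vector_derivative_real_field[OF this] show ?thesis
        by (simp add: cis_conv_exp mult.assoc)
    qed
  qed (auto intro!: continuous_intros)
  moreover have "wave t = (LINT \<tau>|lborel. indicator {0..1} \<tau> *\<^sub>R cis (t * \<tau>))"
    unfolding wave_def by (subst integral_restrict_space) (auto simp: set_lebesgue_integral_def)
  moreover have "(LINT \<tau>|lborel. indicator {0..1} \<tau> *\<^sub>R (\<i> * of_real t * cis (t * \<tau>))) =
      \<i> * of_real t * (LINT \<tau>|lborel. indicator {0..1} \<tau> *\<^sub>R cis (t * \<tau>))"
    by (subst Bochner_Integration.integral_mult_right_zero[symmetric]) (simp add: mult_ac)
  ultimately show ?thesis by simp
qed

lemma fejer_nonneg: "0 \<le> fejer t" and fejer_0: "fejer 0 = 1" and fejer_le_1: "fejer t \<le> 1"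
  using norm_wave_le[of t] by (simp_all add: fejer_def wave_0 power_le_one)

text \<open>\<open>5 = 1 + 4\<close>, from \<open>fejer t \<le> 1\<close> and \<open>t\<^sup>2 fejer t \<le> 4\<close>.\<close>

lemma fejer_le: "fejer t \<le> 5 * inverse (1 + t\<^sup>2)"
proof -
  have "norm (\<i> * of_real t * wave t) \<le> 2"
    unfolding wave_identity using norm_triangle_ineq4[of "cis t" 1] by simp
  then have "(\<bar>t\<bar> * norm (wave t))\<^sup>2 \<le> 2\<^sup>2"
    by (intro power_mono) (auto simp: norm_mult)
  then have "t\<^sup>2 * fejer t \<le> 4" by (simp add: fejer_def power_mult_distrib)
  then have "(1 + t\<^sup>2) * fejer t \<le> 5" using fejer_le_1[of t] by (simp add: algebra_simps)
  then show ?thesis by (simp add: field_simps add_pos_nonneg)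
qed

lemma continuous_wave: "continuous_on UNIV wave"
proof -
  interpret prob_space uniform01 by (rule prob_space_uniform01)
  have "(\<lambda>\<tau>. \<tau>) \<in> borel_measurable uniform01" by (intro measurable_restrict_space1) simp
  from continuous_fourier_integral[OF finite_measure_axioms this] show ?thesis
    by (simp add: wave_def[abs_def])
qed

text \<open>The counterexample: it does not depend on the coordinate in direction \<open>b\<close> and decays in all others. The scaling factor
  makes the frequencies small enough for the unit ball.\<close>

definition ridge :: "'a::euclidean_space \<Rightarrow> 'a \<Rightarrow> real" where
  "ridge b x = (\<Prod>c\<in>Basis - {b}. fejer ((x \<bullet> c) / (2 * real DIM('a))))"

text \<open>Each factor is \<open>fejer t = wave t * wave (-t)\<close>, so \<open>ridge b\<close> is a product of \<open>2 (d - 1)\<close> characteristic functions. It is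
  the characteristic function of the sum of as many independent vectors, each of length at most \<open>1 / (2 d)\<close>.\<close>

lemma ridge_band_limited:
  fixes b :: "'a::euclidean_space"
  assumes b: "b \<in> Basis"
  obtains M :: "('a \<times> real \<Rightarrow> real) measure" and X where "finite_measure M" "X \<in> borel_measurable M"
    "\<And>\<omega>. \<omega> \<in> space M \<Longrightarrow> norm (X \<omega>) \<le> 1"
    "\<And>x. complex_of_real (ridge b x) = (LINT \<omega>|M. cis (x \<bullet> X \<omega>))"
proof -
  define I where "I = (Basis - {b}) \<times> {1, -1 :: real}"
  define N where "N = 2 * real DIM('a)"
  have N: "N > 0" by (simp add: N_def)
  have fin: "finite I" by (simp add: I_def)
  interpret U: prob_space uniform01 by (rule prob_space_uniform01)
  interpret P: product_sigma_finite "\<lambda>_::'a \<times> real. uniform01"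
    by (rule product_sigma_finite.intro) (rule U.sigma_finite_measure_axioms)
  define M where "M = (\<Pi>\<^sub>M i\<in>I. uniform01)"
  interpret M: prob_space M
    unfolding M_def by (intro prob_space_PiM prob_space_uniform01)
  define X :: "('a \<times> real \<Rightarrow> real) \<Rightarrow> 'a" where "X \<omega> = (\<Sum>i\<in>I. (snd i * \<omega> i / N) *\<^sub>R fst i)" for \<omega>
  have [measurable]: "(\<lambda>\<omega>. \<omega> i) \<in> borel_measurable M" if "i \<in> I" for i
  proof -
    have "(\<lambda>\<tau>. \<tau>) \<in> borel_measurable uniform01" by (intro measurable_restrict_space1) simp
    from measurable_compose[OF measurable_component_singleton[OF that] this] show ?thesis
      by (simp add: M_def)
  qed
  have "X \<in> borel_measurable M"
    unfolding X_def by measurable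
  moreover have "norm (X \<omega>) \<le> 1" if "\<omega> \<in> space M" for \<omega>
  proof -
    have "norm (X \<omega>) \<le> (\<Sum>i\<in>I. 1 / N)"
      unfolding X_def
    proof (rule sum_norm_le)
      fix i assume i: "i \<in> I"
      have "\<omega> i \<in> {0..1}" using that i by (auto simp: M_def space_PiM space_restrict_space)
      moreover have "norm (fst i) = 1" "\<bar>snd i\<bar> = 1" using i by (auto simp: I_def)
      ultimately show "norm ((snd i * \<omega> i / N) *\<^sub>R fst i) \<le> 1 / N"
        using N by (simp add: abs_mult divide_right_mono)
    qed
    also have "\<dots> = real (card I) / N" by simp
    also have "\<dots> \<le> 1"
      using b by (simp add: I_def N_def card_cartesian_product card_Diff_singleton)
    finally show ?thesis .
  qed
  moreover have "complex_of_real (ridge b x) = (LINT \<omega>|M. cis (x \<bullet> X \<omega>))" for x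
  proof -
    have "cis (x \<bullet> X \<omega>) = (\<Prod>i\<in>I. cis ((x \<bullet> fst i) * snd i / N * \<omega> i))" for \<omega>
      unfolding X_def inner_sum_right cis_sum[OF fin, symmetric]
      by (intro arg_cong[where f = cis] sum.cong refl) simp
    then have "(LINT \<omega>|M. cis (x \<bullet> X \<omega>)) = (\<Prod>i\<in>I. wave ((x \<bullet> fst i) * snd i / N))"
      unfolding M_def wave_def
      by (simp only:) (rule P.product_integral_prod[OF fin integrable_uniform01_cis])
    also have "\<dots> = (\<Prod>c\<in>Basis - {b}. \<Prod>e\<in>{1, -1}. wave ((x \<bullet> c) * e / N))"
      unfolding I_def by (subst prod.cartesian_product) (simp add: case_prod_unfold)
    also have "\<dots> = (\<Prod>c\<in>Basis - {b}. of_real (fejer ((x \<bullet> c) / N)))"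
      by (intro prod.cong refl) (simp add: fejer_def wave_uminus complex_norm_square[symmetric])
    finally show ?thesis by (simp add: ridge_def N_def)
  qed
  ultimately show thesis
    using that[of M X] M.finite_measure_axioms by blast
qed

lemma ridge_nonneg: "0 \<le> ridge b x" and ridge_le_1: "ridge b x \<le> 1"
  by (auto simp: ridge_def fejer_nonneg fejer_le_1 intro!: prod_nonneg prod_le_1)

lemma ridge_0: "ridge b 0 = 1"
  by (simp add: ridge_def fejer_0)

lemma ridge_translate:
  assumes "b \<in> Basis"
  shows "ridge b (y + t *\<^sub>R b) = ridge b y"
  using assms unfolding ridge_def by (intro prod.cong refl) (auto simp: inner_add_left inner_Basis)

lemma continuous_fejer: "continuous_on UNIV fejer"
  unfolding fejer_def[abs_def] by (intro continuous_intros continuous_wave)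

lemma measurable_fejer [measurable]: "fejer \<in> borel_measurable borel"
  by (intro borel_measurable_continuous_onI continuous_fejer)

lemma continuous_ridge: "continuous_on UNIV (ridge b)"
  unfolding ridge_def[abs_def]
  by (intro continuous_on_prod continuous_on_compose2[OF continuous_fejer] continuous_intros) auto

lemma nn_integral_fejer_scaled_finite:
  assumes N: "1 \<le> N"
  shows "(\<integral>\<^sup>+ t. ennreal (fejer (t / N)) \<partial>lborel) < top"
proof -
  have "fejer (t / N) \<le> 5 * N\<^sup>2 * inverse (1 + t\<^sup>2)" for t
  proof -
    have "inverse (1 + (t / N)\<^sup>2) \<le> N\<^sup>2 * inverse (1 + t\<^sup>2)"
    proof -
      have "1 + t\<^sup>2 \<le> N\<^sup>2 * (1 + (t / N)\<^sup>2)"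
        using N by (simp add: power_divide algebra_simps one_le_power)
      then show ?thesis by (simp add: field_simps add_pos_nonneg)
    qed
    then show ?thesis using fejer_le[of "t / N"] by simp
  qed
  then have "(\<integral>\<^sup>+ t. ennreal (fejer (t / N)) \<partial>lborel) \<le> (\<integral>\<^sup>+ t. ennreal (5 * N\<^sup>2 * inverse (1 + t\<^sup>2)) \<partial>lborel)"
    by (intro nn_integral_mono ennreal_leI) auto
  also have "\<dots> = ennreal (LINT t|lborel. 5 * N\<^sup>2 * inverse (1 + t\<^sup>2))"
    by (intro nn_integral_eq_integral integrable_mult_right integrable_inverse_1_plus_square_real) (auto simp: add_nonneg_nonneg)
  also have "\<dots> < top" by simp
  finally show ?thesis .
qed

text \<open>A ball of radius \<open>r\<close> lies in the slab of width \<open>2 r\<close> orthogonal to \<open>b\<close>. Over this slab the integral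
  factorises into the width and \<open>d - 1\<close> convergent one-dimensional integrals.\<close>

lemma nn_integral_ridge_le:
  fixes b :: "'a::euclidean_space"
  assumes b: "b \<in> Basis"
  shows "\<exists>L>0. \<forall>y. \<forall>r>0. (\<integral>\<^sup>+ x\<in>ball y r. ennreal (ridge b x) \<partial>lborel) \<le> ennreal (L * r)"
proof -
  let ?N = "2 * real DIM('a)"
  define K where "K = (\<integral>\<^sup>+ t. ennreal (fejer (t / ?N)) \<partial>lborel)"
  have "(1::nat) \<le> DIM('a)" using DIM_positive[where 'a='a] by linarith
  then have "1 \<le> ?N" by linarith
  then have "K < top" unfolding K_def by (rule nn_integral_fejer_scaled_finite)
  then obtain k where k: "K = ennreal k" "0 \<le> k" by (cases K) auto
  define L where "L = 2 * k ^ card (Basis - {b}) + 1"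
  have le: "(\<integral>\<^sup>+ x\<in>ball y r. ennreal (ridge b x) \<partial>lborel) \<le> ennreal (L * r)" if r: "r > 0" for y r
  proof -
    define G where "G c t = (if c = b then indicator {y \<bullet> b - r..y \<bullet> b + r} t else ennreal (fejer (t / ?N)))" for c :: 'a and t
    have G [measurable]: "G c \<in> borel_measurable borel" for c
      unfolding G_def by (cases "c = b") simp_all
    have "(\<integral>\<^sup>+ x\<in>ball y r. ennreal (ridge b x) \<partial>lborel) \<le> (\<integral>\<^sup>+ x. (\<Prod>c\<in>Basis. G c (x \<bullet> c)) \<partial>lborel)"
    proof (rule nn_integral_mono)
      fix x :: 'a
      have eq: "(\<Prod>c\<in>Basis. G c (x \<bullet> c)) = G b (x \<bullet> b) * ennreal (ridge b x)"
        unfolding ridge_def prod.remove[OF finite_Basis b]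
        by (simp add: prod_ennreal[symmetric] fejer_nonneg G_def)
      have "x \<bullet> b \<in> {y \<bullet> b - r..y \<bullet> b + r}" if "x \<in> ball y r"
        using Basis_le_norm[OF b, of "x - y"] that by (auto simp: dist_norm norm_minus_commute inner_diff_left abs_le_iff)
      then show "ennreal (ridge b x) * indicator (ball y r) x \<le> (\<Prod>c\<in>Basis. G c (x \<bullet> c))"
        unfolding eq by (auto simp: G_def indicator_def)
    qed
    also have "\<dots> = (\<Prod>c\<in>Basis. (\<integral>\<^sup>+ t. G c t \<partial>lborel))"
      by (rule nn_integral_lborel_prod) (auto simp: G)
    also have "\<dots> = ennreal (2 * r) * (\<Prod>c\<in>Basis - {b}. K)"
    proof -
      have "G b = indicator {y \<bullet> b - r..y \<bullet> b + r}" by (simp add: G_def fun_eq_iff)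
      then have "(\<integral>\<^sup>+ t. G b t \<partial>lborel) = ennreal (2 * r)" using r by simp
      moreover have "(\<integral>\<^sup>+ t. G c t \<partial>lborel) = K" if "c \<in> Basis - {b}" for c
        using that by (simp add: G_def K_def)
      ultimately show ?thesis unfolding prod.remove[OF finite_Basis b] by simp
    qed
    also have "\<dots> = ennreal (2 * r * k ^ card (Basis - {b}))"
      using r k by (simp add: ennreal_mult ennreal_power)
    also have "\<dots> \<le> ennreal (L * r)"
      using r by (intro ennreal_leI) (simp add: L_def algebra_simps)
    finally show ?thesis .
  qed
  have "L > 0" using k by (simp add: L_def add_nonneg_pos)
  with le show ?thesis by blast
qed

text \<open>Over balls of radius \<open>r \<le> 1\<close> use that the function is bounded by 1; the Morrey quotient is then at most the power
  \<open>1/u\<close> of the volume. For \<open>r \<ge> 1\<close> the integral grows only linearly in \<open>r\<close>, so the quotient is at most a constant times \<open>r\<^sup>e\<close>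
  with \<open>e = d/u - (d-1)/p\<close>. The hypothesis relating \<open>p\<close> and \<open>u\<close> says precisely that \<open>e \<le> 0\<close>.\<close>

lemma morrey_norm_ridge_finite:
  fixes b :: "'a::euclidean_space"
  assumes b: "b \<in> Basis" and p: "1 \<le> p" and u: "0 < u"
    and pu: "p \<le> (real DIM('a) - 1) / real DIM('a) * u"
  shows "morrey_norm lborel u p (\<lambda>x::'a. ennreal (ridge b x)) < top"
proof -
  let ?d = "real DIM('a)"
  let ?V = "unit_ball_vol ?d"
  have V: "?V > 0" by simp
  have d: "?d > 0" by simp
  obtain L where L: "L > 0" "\<And>y r. r > 0 \<Longrightarrow> (\<integral>\<^sup>+ x\<in>ball y r. ennreal (ridge b x) \<partial>lborel) \<le> ennreal (L * r)"
    using nn_integral_ridge_le[OF b] by blast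
  define e where "e = ?d * (1 / u - 1 / p) + 1 / p"
  have e: "e \<le> 0"
  proof -
    have "p * ?d \<le> (?d - 1) * u" using pu d by (simp add: field_simps)
    then have "?d / u \<le> (?d - 1) / p" using p u by (simp add: field_simps)
    then show ?thesis by (simp add: e_def field_simps diff_divide_distrib)
  qed
  define C where "C = max (?V powr (1 / u)) (?V powr (1 / u - 1 / p) * L powr (1 / p))"
  have "morrey_norm lborel u p (\<lambda>x::'a. ennreal (ridge b x)) \<le> ennreal C"
    unfolding morrey_norm_def
  proof (rule SUP_least, clarify)
    fix y :: 'a and r :: real assume r: "r > 0"
    let ?J = "\<integral>\<^sup>+ x\<in>ball y r \<inter> space lborel. ennpowr (ennreal (ridge b x)) p \<partial>lborel"
    let ?m = "?V * r ^ DIM('a)"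
    have m: "measure lborel (ball y r \<inter> space lborel) = ?m"
      using r by (simp add: content_ball)
    have m0: "?m > 0" using V r by simp
    have rp: "ridge b x powr p \<le> ridge b x" for x
      using powr_mono'[of 1 p "ridge b x"] p ridge_nonneg[of b x] ridge_le_1[of b x] by simp
    have J1: "?J \<le> ennreal ?m"
    proof -
      have "?J \<le> (\<integral>\<^sup>+ x. indicator (ball y r) x \<partial>lborel)"
        using order_trans[OF rp ridge_le_1]
        by (intro nn_integral_mono) (auto simp: indicator_def ennpowr_ennreal ridge_nonneg)
      also have "\<dots> = ennreal ?m" using r by (simp add: emeasure_ball)
      finally show ?thesis .
    qed
    have J2: "?J \<le> ennreal (L * r)"
    proof -
      have "?J \<le> (\<integral>\<^sup>+ x\<in>ball y r. ennreal (ridge b x) \<partial>lborel)"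
        using rp by (intro nn_integral_mono) (auto simp: indicator_def ennpowr_ennreal ridge_nonneg intro!: ennreal_leI)
      also have "\<dots> \<le> ennreal (L * r)" by (rule L(2)[OF r])
      finally show ?thesis .
    qed
    have bound: "ennreal (?m powr (1 / u - 1 / p)) * ennpowr ?J (1 / p) \<le> ennreal C"
      if "?J \<le> ennreal z" "0 \<le> z" "?m powr (1 / u - 1 / p) * z powr (1 / p) \<le> C" for z
    proof -
      have "ennreal (?m powr (1 / u - 1 / p)) * ennpowr ?J (1 / p) \<le>
          ennreal (?m powr (1 / u - 1 / p)) * ennreal (z powr (1 / p))"
        using p that by (intro mult_left_mono ennpowr_le) auto
      also have "\<dots> = ennreal (?m powr (1 / u - 1 / p) * z powr (1 / p))"
        by (simp add: ennreal_mult)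
      also have "\<dots> \<le> ennreal C" using that by (intro ennreal_leI)
      finally show ?thesis .
    qed
    show "ennreal (measure lborel (ball y r \<inter> space lborel) powr (1 / u - 1 / p)) * ennpowr ?J (1 / p) \<le> ennreal C"
      unfolding m
    proof (cases "r \<le> 1")
      case True
      have "?m powr (1 / u - 1 / p) * ?m powr (1 / p) = ?m powr (1 / u)"
        by (simp add: powr_add[symmetric])
      also have "\<dots> \<le> ?V powr (1 / u)"
        using True r V u by (intro powr_mono2) (auto intro!: mult_left_le power_le_one)
      finally show "ennreal (?m powr (1 / u - 1 / p)) * ennpowr ?J (1 / p) \<le> ennreal C"
        using m0 by (intro bound[OF J1]) (auto simp: C_def)
    next
      case False
      have "?m powr (1 / u - 1 / p) * (L * r) powr (1 / p) =
          (?V powr (1 / u - 1 / p) * L powr (1 / p)) * ((r ^ DIM('a)) powr (1 / u - 1 / p) * r powr (1 / p))"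
        using V r L by (simp add: powr_mult)
      also have "(r ^ DIM('a)) powr (1 / u - 1 / p) * r powr (1 / p) = r powr e"
        using r by (simp add: powr_realpow[symmetric] powr_powr powr_add[symmetric] e_def)
      also have "(?V powr (1 / u - 1 / p) * L powr (1 / p)) * r powr e \<le> (?V powr (1 / u - 1 / p) * L powr (1 / p)) * 1"
        using False e powr_mono[of e 0 r] r by (intro mult_left_mono) auto
      finally show "ennreal (?m powr (1 / u - 1 / p)) * ennpowr ?J (1 / p) \<le> ennreal C"
        using r L by (intro bound[OF J2]) (auto simp: C_def)
    qed
  qed
  also have "\<dots> < top" by simp
  finally show ?thesis .
qed

text \<open>All slices of \<open>ridge b\<close> in direction \<open>b\<close> near the origin are positive constants, which have infinite norm on the line. So the
  Fubini norm is infinite, while the function belongs to the space.\<close>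

theorem lemma10:
  fixes \<phi> :: "'a::euclidean_space \<Rightarrow> real" and \<psi> :: "real \<Rightarrow> real"
    and s u p :: real and q :: ennreal
  assumes "dyadic_generator \<phi>" and "dyadic_generator \<psi>"
    and "s > 0" and "1 \<le> p" and "p < u" and "1 \<le> q"
    and "DIM('a) \<ge> 2"
    and "p \<le> (real DIM('a) - 1) / real DIM('a) * u"
  shows "\<not> fubini_property \<phi> \<psi> s u p q"
proof
  assume "fubini_property \<phi> \<psi> s u p q"
  then obtain C where C: "\<And>f. f \<in> tlm_space \<phi> s u p q \<Longrightarrow>
      tlm_fubini_norm \<psi> s u p q f \<le> ennreal C * tlm_norm \<phi> s u p q f"
    unfolding fubini_property_def by blast
  have u: "0 < u" using assms by linarith
  obtain b :: 'a where b: "b \<in> Basis" using SOME_Basis by blast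
  obtain M :: "('a \<times> real \<Rightarrow> real) measure" and X where M: "finite_measure M" "X \<in> borel_measurable M"
    "\<And>\<omega>. \<omega> \<in> space M \<Longrightarrow> norm (X \<omega>) \<le> 1"
    "\<And>x. complex_of_real (ridge b x) = (LINT \<omega>|M. cis (x \<bullet> X \<omega>))"
    using ridge_band_limited[OF b] by blast
  have "tlm_norm \<phi> s u p q (ridge b) = morrey_norm lborel u p (\<lambda>x. ennreal (ridge b x))"
    by (rule tlm_norm_band_limited[OF assms(1) M ridge_nonneg assms(6)])
  also have "\<dots> < top"
    by (rule morrey_norm_ridge_finite[OF b assms(4) u assms(8)])
  finally have fin: "tlm_norm \<phi> s u p q (ridge b) < top" .
  have "tempered_fun (\<lambda>x. complex_of_real (ridge b x))"
    by (rule band_limited_tempered[OF assms(1) M])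
  then have "tlm_fubini_norm \<psi> s u p q (ridge b) \<le> ennreal C * tlm_norm \<phi> s u p q (ridge b)"
    using fin by (intro C) (simp add: tlm_space_def)
  also have "\<dots> < top"
    using fin by (simp add: ennreal_mult_less_top)
  finally have less: "tlm_fubini_norm \<psi> s u p q (ridge b) < top" .
  have "(ridge b \<longlongrightarrow> ridge b 0) (nhds 0)"
    using continuous_ridge[of b]
    by (simp add: continuous_on_eq_continuous_at isCont_def tendsto_at_iff_tendsto_nhds)
  then have "\<forall>\<^sub>F y in nhds 0. 0 < ridge b y"
    by (rule order_tendstoD) (simp add: ridge_0)
  then obtain r where r: "r > 0" "\<And>y. norm y < r \<Longrightarrow> 0 < ridge b y"
    by (auto simp: eventually_nhds_metric)
  have "morrey_norm (hyperplane_lborel b) u p (\<lambda>y. tlm_norm \<psi> s u p q (\<lambda>t. ridge b (y + t *\<^sub>R b))) = top"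
    using r(2) by (intro morrey_norm_hyperplane_eq_top[OF b r(1)])
      (simp add: ridge_translate[OF b] tlm_norm_const_eq_top[OF assms(2) _ assms(4) u assms(6)])
  then have "tlm_fubini_norm \<psi> s u p q (ridge b) = top"
    unfolding tlm_fubini_norm_def sum.remove[OF finite_Basis b] by simp
  with less show False by simp
qed

end
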